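(* Let $F$ be a field of characteristic zero and $n\ge1$. Then $\mathrm{rb}(M_n(F))=2n-1$.
   Context: A linear operator $R$ on $A$ is a Rota–Baxter operator of weight $0$ if $R(x)R(y)=R(R(x)y+xR(y))$ for all $x,y\in A$. The RB-index $\mathrm{rb}(A)$ is the least $n\in\mathbb N$ such that $R^n=0$ for every Rota–Baxter operator $R$ of weight zero on $A$ ($\infty$ if no such $n$ exists). *)

theory Defs
  imports "Jordan_Normal_Form.Matrix" "HOL-Library.Extended_Nat"
begin

text \<open>Rota--Baxter operators of weight zero on the matrix algebra M_n(F),
  realised as F-linear maps on carrier_mat n n (values outside the carrier are irrelevant).\<close>

definition rb_operator :: "nat \<Rightarrow> ('a::field mat \<Rightarrow> 'a mat) \<Rightarrow> bool" where
  "rb_operator n R \<longleftrightarrow>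
     (\<forall>x\<in>carrier_mat n n. R x \<in> carrier_mat n n) \<and>
     (\<forall>x\<in>carrier_mat n n. \<forall>y\<in>carrier_mat n n. R (x + y) = R x + R y) \<and>
     (\<forall>c. \<forall>x\<in>carrier_mat n n. R (c \<cdot>\<^sub>m x) = c \<cdot>\<^sub>m R x) \<and>
     (\<forall>x\<in>carrier_mat n n. \<forall>y\<in>carrier_mat n n. R x * R y = R (R x * y + x * R y))"

definition rb_nilpotent_of :: "nat \<Rightarrow> nat \<Rightarrow> ('a::field mat \<Rightarrow> 'a mat) \<Rightarrow> bool" where
  "rb_nilpotent_of n m R \<longleftrightarrow> (\<forall>x\<in>carrier_mat n n. (R ^^ m) x = 0\<^sub>m n n)"

definition rb_index :: "'a::field itself \<Rightarrow> nat \<Rightarrow> enat" where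
  "rb_index T n =
     (if \<exists>m. \<forall>R::'a mat \<Rightarrow> 'a mat. rb_operator n R \<longrightarrow> rb_nilpotent_of n m R
      then enat (LEAST m. \<forall>R::'a mat \<Rightarrow> 'a mat. rb_operator n R \<longrightarrow> rb_nilpotent_of n m R)
      else \<infinity>)"

end

theory Submission
  imports Defs "Jordan_Normal_Form.Determinant"
begin

text \<open>
  Let \<open>a = R(1)\<close>. The Rota--Baxter identity gives \<open>a\<^sup>k = k! R\<^sup>k(1)\<close>, forces \<open>a\<close> to be nilpotent
  in characteristic zero, and yields \<open>[L, R\<^sup>s] = s R\<^sup>s\<^sup>+\<^sup>1\<close> where \<open>L\<close> is left or right
  multiplication by \<open>a\<close>. As \<open>L\<^sup>n = 0\<close>, iterating the commutator expresses \<open>R\<^sup>2\<^sup>n\<^sup>-\<^sup>1(x)\<close> both as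
  \<open>c b R(b x)\<close> and as \<open>c R(x b) b\<close> with \<open>b = a\<^sup>n\<^sup>-\<^sup>1\<close>. If \<open>b \<noteq> 0\<close>, then \<open>a\<close> may be taken to be the
  nilpotent shift, and everything is governed by one scalar \<open>\<lambda>\<close> such that the last row of
  \<open>R(E\<^sub>1\<^sub>k)\<close> is \<open>\<lambda> \<delta>\<^sub>1\<^sub>k\<close> times the last unit vector. If \<open>\<lambda> \<noteq> 0\<close>, choose the smallest
  \<open>E = \<langle>e\<^sub>1, \<dots>, e\<^sub>l\<rangle>\<close> such that every \<open>R(E\<^sub>1\<^sub>k)\<close> acts on \<open>V/E\<close> as \<open>\<lambda> \<delta>\<^sub>1\<^sub>k\<close>. By minimality
  \<open>R(x)\<close> acts on \<open>V/E\<close> as a scalar \<open>\<nu>(x)\<close> for every \<open>x\<close> with image in \<open>E\<close>, and \<open>R\<close> together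
  with \<open>\<nu>\<close> induces a Rota--Baxter operator whose value at the identity has the eigenvalue
  \<open>\<nu>(1) = l \<lambda>\<close>. It is nilpotent, so \<open>\<lambda> = 0\<close>.
\<close>

section \<open>Structure constants\<close>

text \<open>\<open>r p q i j\<close> stands for the entry \<open>(i, j)\<close> of the image of the matrix unit \<open>E\<^sub>p\<^sub>q\<close>.\<close>

definition rb_const :: "nat \<Rightarrow> (nat \<Rightarrow> nat \<Rightarrow> nat \<Rightarrow> nat \<Rightarrow> 'a::comm_ring_1) \<Rightarrow> bool" where
  "rb_const n r \<longleftrightarrow> (\<forall>p<n. \<forall>q<n. \<forall>s<n. \<forall>t<n. \<forall>i<n. \<forall>j<n.
     (\<Sum>m<n. r p q i m * r s t m j) =
     (\<Sum>m<n. r p q m s * r m t i j) + (\<Sum>m<n. r s t q m * r p m i j))"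

lemma rb_constD:
  assumes "rb_const n r" "p < n" "q < n" "s < n" "t < n" "i < n" "j < n"
  shows "(\<Sum>m<n. r p q i m * r s t m j) =
     (\<Sum>m<n. r p q m s * r m t i j) + (\<Sum>m<n. r s t q m * r p m i j)"
  using assms unfolding rb_const_def by blast

section \<open>Matrix units, and the passage between operators and structure constants\<close>

definition mat_unit :: "nat \<Rightarrow> nat \<Rightarrow> nat \<Rightarrow> 'a::zero_neq_one mat" where
  "mat_unit n p q = mat n n (\<lambda>ij. if ij = (p, q) then 1 else 0)"

lemma mat_unit_carrier [simp]: "mat_unit n p q \<in> carrier_mat n n"
  by (simp add: mat_unit_def)

lemma mat_unit_dim [simp]: "dim_row (mat_unit n p q) = n" "dim_col (mat_unit n p q) = n"
  by (simp_all add: mat_unit_def)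

lemma mat_unit_index [simp]:
  "i < n \<Longrightarrow> j < n \<Longrightarrow> mat_unit n p q $$ (i, j) = (if i = p \<and> j = q then 1 else 0)"
  by (simp add: mat_unit_def)

lemma index_mult_mat_sum:
  assumes "A \<in> carrier_mat n m" "B \<in> carrier_mat m k" "i < n" "j < k"
  shows "(A * B) $$ (i, j) = (\<Sum>l<m. A $$ (i, l) * B $$ (l, j))"
  using assms by (auto simp: scalar_prod_def lessThan_atLeast0 intro!: sum.cong)

lemma mat_unit_mult_index:
  fixes Y :: "'a::semiring_1 mat"
  assumes "Y \<in> carrier_mat n n" "q < n" "i < n" "j < n"
  shows "(mat_unit n p q * Y) $$ (i, j) = (if i = p then Y $$ (q, j) else 0)"
proof -
  have "(mat_unit n p q * Y) $$ (i, j) = (\<Sum>m<n. if m = q then (if i = p then Y $$ (q, j) else 0) else 0)"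
    unfolding index_mult_mat_sum[OF mat_unit_carrier assms(1,3,4)] using assms
    by (intro sum.cong) auto
  then show ?thesis using assms by simp
qed

lemma mult_mat_unit_index:
  fixes Y :: "'a::semiring_1 mat"
  assumes "Y \<in> carrier_mat n n" "p < n" "i < n" "j < n"
  shows "(Y * mat_unit n p q) $$ (i, j) = (if j = q then Y $$ (i, p) else 0)"
proof -
  have "(Y * mat_unit n p q) $$ (i, j) = (\<Sum>m<n. if m = p then (if j = q then Y $$ (i, p) else 0) else 0)"
    unfolding index_mult_mat_sum[OF assms(1) mat_unit_carrier assms(3,4)] using assms
    by (intro sum.cong) auto
  then show ?thesis using assms by simp
qed

lemma rb_operatorD:
  assumes "rb_operator n R" "x \<in> carrier_mat n n"
  shows rb_operator_closed: "R x \<in> carrier_mat n n"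
    and rb_operator_add: "y \<in> carrier_mat n n \<Longrightarrow> R (x + y) = R x + R y"
    and rb_operator_smult: "R (c \<cdot>\<^sub>m x) = c \<cdot>\<^sub>m R x"
    and rb_operator_mult: "y \<in> carrier_mat n n \<Longrightarrow> R x * R y = R (R x * y + x * R y)"
  using assms unfolding rb_operator_def by blast+

lemma rb_operator_zero:
  assumes "rb_operator n R"
  shows "R (0\<^sub>m n n) = 0\<^sub>m n n"
proof -
  have "R (0 \<cdot>\<^sub>m 0\<^sub>m n n) = 0 \<cdot>\<^sub>m R (0\<^sub>m n n)"
    by (rule rb_operator_smult[OF assms]) simp
  moreover have "(0::'a) \<cdot>\<^sub>m 0\<^sub>m n n = 0\<^sub>m n n" by (intro eq_matI) auto
  moreover have "(0::'a) \<cdot>\<^sub>m R (0\<^sub>m n n) = 0\<^sub>m n n"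
    using rb_operator_closed[OF assms, of "0\<^sub>m n n"] by (intro eq_matI) auto
  ultimately show ?thesis by simp
qed

text \<open>Linearity is available for binary sums only, so \<open>x\<close> is built up one
  position at a time: \<open>?M A\<close> keeps the entries at the positions in
  \<open>A\<close>.\<close>

lemma rb_operator_index:
  assumes R: "rb_operator n R" and x: "x \<in> carrier_mat n n" and ij: "i < n" "j < n"
  shows "R x $$ (i, j) = (\<Sum>p<n. \<Sum>q<n. x $$ (p, q) * R (mat_unit n p q) $$ (i, j))"
proof -
  let ?M = "\<lambda>A. mat n n (\<lambda>pq. if pq \<in> A then x $$ pq else 0)"
  have part: "R (?M A) $$ (i, j) = (\<Sum>(p, q)\<in>A. x $$ (p, q) * R (mat_unit n p q) $$ (i, j))"
    if "finite A" "A \<subseteq> {..<n} \<times> {..<n}" for A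
    using that
  proof (induction A rule: finite_induct)
    case empty
    have "?M {} = 0\<^sub>m n n" by (intro eq_matI) auto
    then show ?case using rb_operator_zero[OF R] ij by simp
  next
    case (insert pq A)
    obtain p q where pq: "pq = (p, q)" by fastforce
    have "?M (insert pq A) = ?M A + x $$ (p, q) \<cdot>\<^sub>m mat_unit n p q"
      using insert.hyps by (intro eq_matI) (auto simp: pq)
    then have "R (?M (insert pq A)) = R (?M A) + x $$ (p, q) \<cdot>\<^sub>m R (mat_unit n p q)"
      by (simp add: rb_operator_add[OF R] rb_operator_smult[OF R])
    then have "R (?M (insert pq A)) $$ (i, j) =
        R (?M A) $$ (i, j) + x $$ (p, q) * R (mat_unit n p q) $$ (i, j)"
      using rb_operator_closed[OF R, of "?M A"] rb_operator_closed[OF R, of "mat_unit n p q"] ij by simp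
    then show ?case using insert by (simp add: pq)
  qed
  have "?M ({..<n} \<times> {..<n}) = x" using x by (intro eq_matI) auto
  then show ?thesis using part[of "{..<n} \<times> {..<n}"] by (simp add: sum.cartesian_product)
qed

definition op_of_const :: "nat \<Rightarrow> (nat \<Rightarrow> nat \<Rightarrow> nat \<Rightarrow> nat \<Rightarrow> 'a) \<Rightarrow> 'a::comm_ring_1 mat \<Rightarrow> 'a mat" where
  "op_of_const n r x = mat n n (\<lambda>(i, j). \<Sum>p<n. \<Sum>q<n. x $$ (p, q) * r p q i j)"

lemma op_of_const_carrier [simp]: "op_of_const n r x \<in> carrier_mat n n"
  by (simp add: op_of_const_def)

lemma op_of_const_index [simp]:
  "i < n \<Longrightarrow> j < n \<Longrightarrow> op_of_const n r x $$ (i, j) = (\<Sum>p<n. \<Sum>q<n. x $$ (p, q) * r p q i j)"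
  by (simp add: op_of_const_def)

lemma rb_operator_op_of_const:
  fixes r :: "nat \<Rightarrow> nat \<Rightarrow> nat \<Rightarrow> nat \<Rightarrow> 'a::field"
  assumes "rb_const n r"
  shows "rb_operator n (op_of_const n r)"
proof -
  let ?R = "op_of_const n r"
  have "?R x * ?R y = ?R (?R x * y + x * ?R y)"
    if x: "x \<in> carrier_mat n n" and y: "y \<in> carrier_mat n n" for x y
  proof (rule eq_matI)
    fix i j assume "i < dim_row (?R (?R x * y + x * ?R y))" "j < dim_col (?R (?R x * y + x * ?R y))"
    then have ij: "i < n" "j < n" by (simp_all add: op_of_const_def)
    let ?S = "{..<n}"
    have "(?R x * ?R y) $$ (i, j) = (\<Sum>m<n. (\<Sum>p<n. \<Sum>q<n. x $$ (p, q) * r p q i m) *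
        (\<Sum>s<n. \<Sum>t<n. y $$ (s, t) * r s t m j))"
      using ij by (simp add: index_mult_mat_sum[of _ n n _ n])
    \<comment> \<open>Gathering the five summations into one sum over tuples makes each change of
      order a single reindexing.\<close>
    also have "\<dots> = (\<Sum>(m,s,t,p,q)\<in>?S \<times> ?S \<times> ?S \<times> ?S \<times> ?S.
        x $$ (p, q) * y $$ (s, t) * (r p q i m * r s t m j))"
      by (simp add: sum_distrib_left sum_distrib_right sum.cartesian_product[symmetric]
          mult.assoc mult.left_commute)
    also have "\<dots> = (\<Sum>(p,q,s,t,m)\<in>?S \<times> ?S \<times> ?S \<times> ?S \<times> ?S.
        x $$ (p, q) * y $$ (s, t) * (r p q i m * r s t m j))"
      by (rule sum.reindex_bij_witness[where j = "\<lambda>(m,s,t,p,q). (p,q,s,t,m)"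
          and i = "\<lambda>(p,q,s,t,m). (m,s,t,p,q)"]) auto
    also have "\<dots> = (\<Sum>p<n. \<Sum>q<n. \<Sum>s<n. \<Sum>t<n.
        x $$ (p, q) * y $$ (s, t) * (\<Sum>m<n. r p q i m * r s t m j))"
      by (simp add: sum.cartesian_product[symmetric] sum_distrib_left)
    also have "\<dots> = (\<Sum>p<n. \<Sum>q<n. \<Sum>s<n. \<Sum>t<n. x $$ (p, q) * y $$ (s, t) *
        ((\<Sum>m<n. r p q m s * r m t i j) + (\<Sum>m<n. r s t q m * r p m i j)))"
      using ij by (intro sum.cong refl arg_cong2[where f = "(*)"] rb_constD[OF assms]) auto
    also have "\<dots> = (\<Sum>(p,q,s,t,m)\<in>?S \<times> ?S \<times> ?S \<times> ?S \<times> ?S.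
          x $$ (p, q) * y $$ (s, t) * (r p q m s * r m t i j)) +
        (\<Sum>(p,q,s,t,m)\<in>?S \<times> ?S \<times> ?S \<times> ?S \<times> ?S.
          x $$ (p, q) * y $$ (s, t) * (r s t q m * r p m i j))"
      by (simp add: sum.cartesian_product[symmetric] sum_distrib_left distrib_left sum.distrib)
    also have "(\<Sum>(p,q,s,t,m)\<in>?S \<times> ?S \<times> ?S \<times> ?S \<times> ?S.
          x $$ (p, q) * y $$ (s, t) * (r p q m s * r m t i j)) =
        (\<Sum>(m,t,s,p,q)\<in>?S \<times> ?S \<times> ?S \<times> ?S \<times> ?S.
          x $$ (p, q) * r p q m s * y $$ (s, t) * r m t i j)"
      by (rule sum.reindex_bij_witness[where i = "\<lambda>(m,t,s,p,q). (p,q,s,t,m)"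
          and j = "\<lambda>(p,q,s,t,m). (m,t,s,p,q)"]) auto
    also have "\<dots> = (\<Sum>m<n. \<Sum>t<n. (?R x * y) $$ (m, t) * r m t i j)"
      using y by (simp add: index_mult_mat_sum[of _ n n _ n] sum.cartesian_product[symmetric]
          sum_distrib_right)
    also have "(\<Sum>(p,q,s,t,m)\<in>?S \<times> ?S \<times> ?S \<times> ?S \<times> ?S.
          x $$ (p, q) * y $$ (s, t) * (r s t q m * r p m i j)) =
        (\<Sum>(p,m,q,s,t)\<in>?S \<times> ?S \<times> ?S \<times> ?S \<times> ?S.
          x $$ (p, q) * (y $$ (s, t) * r s t q m) * r p m i j)"
      by (rule sum.reindex_bij_witness[where i = "\<lambda>(p,m,q,s,t). (p,q,s,t,m)"
          and j = "\<lambda>(p,q,s,t,m). (p,m,q,s,t)"]) auto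
    also have "\<dots> = (\<Sum>p<n. \<Sum>m<n. (x * ?R y) $$ (p, m) * r p m i j)"
      using x by (simp add: index_mult_mat_sum[of _ n n _ n] sum.cartesian_product[symmetric]
          sum_distrib_right sum_distrib_left)
    also have "(\<Sum>m<n. \<Sum>t<n. (?R x * y) $$ (m, t) * r m t i j) +
        (\<Sum>m<n. \<Sum>t<n. (x * ?R y) $$ (m, t) * r m t i j) =
        (\<Sum>m<n. \<Sum>t<n. (?R x * y + x * ?R y) $$ (m, t) * r m t i j)"
    proof -
      have "(?R x * y + x * ?R y) $$ (m, t) = (?R x * y) $$ (m, t) + (x * ?R y) $$ (m, t)"
        if "m < n" "t < n" for m t
        using that mult_carrier_mat[OF x, of "?R y" n] by (subst index_add_mat) auto
      then show ?thesis by (simp add: sum.distrib[symmetric] distrib_right del: index_add_mat index_mult_mat)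
    qed
    also have "\<dots> = ?R (?R x * y + x * ?R y) $$ (i, j)"
      using ij by simp
    finally show "(?R x * ?R y) $$ (i, j) = ?R (?R x * y + x * ?R y) $$ (i, j)" .
  qed (simp_all add: op_of_const_def)
  moreover have "?R (x + y) = ?R x + ?R y" if "x \<in> carrier_mat n n" "y \<in> carrier_mat n n" for x y
    using that by (intro eq_matI)
      (auto simp: op_of_const_def distrib_right sum.distrib)
  moreover have "?R (c \<cdot>\<^sub>m x) = c \<cdot>\<^sub>m ?R x" if "x \<in> carrier_mat n n" for c x
    using that by (intro eq_matI) (auto simp: op_of_const_def sum_distrib_left mult.assoc)
  ultimately show ?thesis unfolding rb_operator_def by simp
qed

lemma rb_const_of_operator:
  fixes R :: "'a::field mat \<Rightarrow> 'a mat"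
  assumes R: "rb_operator n R"
  shows "rb_const n (\<lambda>p q i j. R (mat_unit n p q) $$ (i, j))"
  unfolding rb_const_def
proof (intro allI impI)
  fix p q s t i j assume b: "p < n" "q < n" "s < n" "t < n" "i < n" "j < n"
  let ?E = "mat_unit n :: nat \<Rightarrow> nat \<Rightarrow> 'a mat"
  note cl = rb_operator_closed[OF R mat_unit_carrier]
  let ?z = "R (?E p q) * ?E s t + ?E p q * R (?E s t)"
  have z: "?z \<in> carrier_mat n n"
    using cl by (intro add_carrier_mat mult_carrier_mat[of _ n n]) auto
  \<comment> \<open>Right multiplication by \<open>?E s t\<close> moves column \<open>s\<close> to
    column \<open>t\<close>; left multiplication by \<open>?E p q\<close> moves row \<open>q\<close>
    to row \<open>p\<close>. All else is erased.\<close>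
  have zi: "?z $$ (a, c) = (if c = t then R (?E p q) $$ (a, s) else 0) +
      (if a = p then R (?E s t) $$ (q, c) else 0)" if ac: "a < n" "c < n" for a c
  proof -
    have "?z $$ (a, c) = (R (?E p q) * ?E s t) $$ (a, c) + (?E p q * R (?E s t)) $$ (a, c)"
      using cl[of s t] ac by (subst index_add_mat) auto
    then show ?thesis
      using mult_mat_unit_index[OF cl b(3) ac] mat_unit_mult_index[OF cl b(2) ac] by simp
  qed
  have "(\<Sum>m<n. R (?E p q) $$ (i, m) * R (?E s t) $$ (m, j)) = (R (?E p q) * R (?E s t)) $$ (i, j)"
    using index_mult_mat_sum[OF cl cl] b by simp
  also have "\<dots> = R ?z $$ (i, j)"
    using rb_operator_mult[OF R mat_unit_carrier mat_unit_carrier] by simp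
  also have "\<dots> = (\<Sum>a<n. \<Sum>c<n. ?z $$ (a, c) * R (?E a c) $$ (i, j))"
    by (rule rb_operator_index[OF R z]) (use b in auto)
  also have "\<dots> = (\<Sum>a<n. \<Sum>c<n. (if c = t then R (?E p q) $$ (a, s) * R (?E a t) $$ (i, j) else 0) +
      (if a = p then R (?E s t) $$ (q, c) * R (?E p c) $$ (i, j) else 0))"
    by (intro sum.cong refl) (simp add: zi algebra_simps del: index_add_mat index_mult_mat)
  also have "\<dots> = (\<Sum>a<n. \<Sum>c<n. if c = t then R (?E p q) $$ (a, s) * R (?E a t) $$ (i, j) else 0) +
      (\<Sum>c<n. \<Sum>a<n. if a = p then R (?E s t) $$ (q, c) * R (?E p c) $$ (i, j) else 0)"
    unfolding sum.distrib by (subst (2) sum.swap) simp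
  also have "\<dots> = (\<Sum>m<n. R (?E p q) $$ (m, s) * R (?E m t) $$ (i, j)) +
      (\<Sum>m<n. R (?E s t) $$ (q, m) * R (?E p m) $$ (i, j))"
    using b by simp
  finally show "(\<Sum>m<n. R (?E p q) $$ (i, m) * R (?E s t) $$ (m, j)) =
      (\<Sum>m<n. R (?E p q) $$ (m, s) * R (?E m t) $$ (i, j)) +
      (\<Sum>m<n. R (?E s t) $$ (q, m) * R (?E p m) $$ (i, j))" .
qed

section \<open>Nilpotency of the image of the identity\<close>

lemma pow_mat_add:
  fixes A :: "'a::semiring_1 mat"
  assumes A: "A \<in> carrier_mat n n"
  shows "A ^\<^sub>m (j + k) = A ^\<^sub>m j * A ^\<^sub>m k"
proof (induction k)
  case 0
  then show ?case using A by simp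
next
  case (Suc k)
  then show ?case
    using A by (simp add: assoc_mult_mat[OF pow_carrier_mat[OF A] pow_carrier_mat[OF A] A])
qed

section \<open>Commutators of powers of R with multiplication by R(1)\<close>

lemma rb_operator_funpow_closed:
  assumes "rb_operator n R" "x \<in> carrier_mat n n"
  shows "(R ^^ k) x \<in> carrier_mat n n"
  by (induction k) (use assms rb_operator_closed[OF assms(1)] in auto)

lemma rb_operator_funpow_smult:
  assumes R: "rb_operator n R" and x: "x \<in> carrier_mat n n"
  shows "(R ^^ k) (c \<cdot>\<^sub>m x) = c \<cdot>\<^sub>m (R ^^ k) x"
  by (induction k) (use rb_operator_smult[OF R rb_operator_funpow_closed[OF R x]] in auto)

lemma rb_operator_funpow_zero:
  assumes "rb_operator n R"
  shows "(R ^^ k) (0\<^sub>m n n) = 0\<^sub>m n n"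
  by (induction k) (use rb_operator_zero[OF assms] in auto)

text \<open>With \<open>1\<close> as first factor the Rota--Baxter identity reads a R(z) = R(a z) +
  R(R(z)). Each of the \<open>s\<close> passages of a past an R contributes one copy of
  R^(s+1).\<close>

lemma rb_one_mult_funpow:
  assumes R: "rb_operator n R" and y: "y \<in> carrier_mat n n"
  shows "R (1\<^sub>m n) * (R ^^ s) y = (R ^^ s) (R (1\<^sub>m n) * y) + of_nat s \<cdot>\<^sub>m (R ^^ Suc s) y"
proof (induction s)
  case 0
  have "R (1\<^sub>m n) * y \<in> carrier_mat n n"
    by (rule mult_carrier_mat[OF rb_operator_closed[OF R one_carrier_mat] y])
  moreover have "R y \<in> carrier_mat n n" by (rule rb_operator_closed[OF R y])
  ultimately show ?case by (intro eq_matI) auto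
next
  case (Suc s)
  let ?a = "R (1\<^sub>m n)" and ?z = "(R ^^ s) y" and ?w = "(R ^^ s) (R (1\<^sub>m n) * y)"
  have a: "?a \<in> carrier_mat n n" by (simp add: rb_operator_closed[OF R])
  have z: "?z \<in> carrier_mat n n" by (rule rb_operator_funpow_closed[OF R y])
  have w: "?w \<in> carrier_mat n n"
    by (rule rb_operator_funpow_closed[OF R mult_carrier_mat[OF a y]])
  have Rz: "R ?z \<in> carrier_mat n n" by (rule rb_operator_closed[OF R z])
  have "?a * R ?z = R (?a * ?z + 1\<^sub>m n * R ?z)"
    by (rule rb_operator_mult[OF R _ z]) simp
  also have "?a * ?z + 1\<^sub>m n * R ?z = ?w + of_nat (Suc s) \<cdot>\<^sub>m R ?z"
    unfolding Suc using w Rz by (intro eq_matI) (auto simp: algebra_simps)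
  also have "R \<dots> = R ?w + of_nat (Suc s) \<cdot>\<^sub>m R (R ?z)"
    using rb_operator_add[OF R w] rb_operator_smult[OF R Rz] Rz by simp
  finally show ?case by simp
qed

text \<open>Mirror image, with \<open>1\<close> as second factor. The correction term is the same as
  on the left, so it cancels when the two formulas are subtracted.\<close>

lemma rb_funpow_mult_one:
  assumes R: "rb_operator n R" and y: "y \<in> carrier_mat n n"
  shows "(R ^^ s) y * R (1\<^sub>m n) = (R ^^ s) (y * R (1\<^sub>m n)) + of_nat s \<cdot>\<^sub>m (R ^^ Suc s) y"
proof (induction s)
  case 0
  have "y * R (1\<^sub>m n) \<in> carrier_mat n n" "R y \<in> carrier_mat n n"
    using rb_operator_closed[OF R] y by (auto intro: mult_carrier_mat)
  then show ?case by (intro eq_matI) auto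
next
  case (Suc s)
  let ?a = "R (1\<^sub>m n)" and ?z = "(R ^^ s) y" and ?w = "(R ^^ s) (y * R (1\<^sub>m n))"
  have a: "?a \<in> carrier_mat n n" by (simp add: rb_operator_closed[OF R])
  have z: "?z \<in> carrier_mat n n" by (rule rb_operator_funpow_closed[OF R y])
  have w: "?w \<in> carrier_mat n n"
    by (rule rb_operator_funpow_closed[OF R mult_carrier_mat[OF y a]])
  have Rz: "R ?z \<in> carrier_mat n n" by (rule rb_operator_closed[OF R z])
  have "R ?z * ?a = R (R ?z * 1\<^sub>m n + ?z * ?a)"
    by (rule rb_operator_mult[OF R z]) simp
  also have "R ?z * 1\<^sub>m n + ?z * ?a = ?w + of_nat (Suc s) \<cdot>\<^sub>m R ?z"
    unfolding Suc using w Rz by (intro eq_matI) (auto simp: algebra_simps)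
  also have "R \<dots> = R ?w + of_nat (Suc s) \<cdot>\<^sub>m R (R ?z)"
    using rb_operator_add[OF R w] rb_operator_smult[OF R Rz] Rz by simp
  finally show ?case by simp
qed

text \<open>In the right commutator at \<open>1\<close>, the term R^k(a) is itself R^(k+1)(1), so
  another factor a brings out the number k+1.\<close>

lemma rb_one_pow:
  assumes R: "rb_operator n R"
  shows "R (1\<^sub>m n) ^\<^sub>m k = fact k \<cdot>\<^sub>m (R ^^ k) (1\<^sub>m n)"
proof (induction k)
  case 0
  have "dim_row (R (1\<^sub>m n)) = n" using rb_operator_closed[OF R, of "1\<^sub>m n"] by simp
  then show ?case by (intro eq_matI) auto
next
  case (Suc k)
  let ?a = "R (1\<^sub>m n)"
  have a: "?a \<in> carrier_mat n n" by (simp add: rb_operator_closed[OF R])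
  have z: "(R ^^ j) (1\<^sub>m n) \<in> carrier_mat n n" for j by (rule rb_operator_funpow_closed[OF R]) simp
  have "?a ^\<^sub>m Suc k = fact k \<cdot>\<^sub>m ((R ^^ k) (1\<^sub>m n) * ?a)"
    using Suc mult_smult_assoc_mat[OF z a] by simp
  also have "(R ^^ k) (1\<^sub>m n) * ?a = (R ^^ k) ?a + of_nat k \<cdot>\<^sub>m (R ^^ Suc k) (1\<^sub>m n)"
    using rb_funpow_mult_one[OF R, of "1\<^sub>m n" k] a by simp
  also have "(R ^^ k) ?a = (R ^^ Suc k) (1\<^sub>m n)" by (simp add: funpow_swap1)
  also have "fact k \<cdot>\<^sub>m ((R ^^ Suc k) (1\<^sub>m n) + of_nat k \<cdot>\<^sub>m (R ^^ Suc k) (1\<^sub>m n)) =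
      fact (Suc k) \<cdot>\<^sub>m (R ^^ Suc k) (1\<^sub>m n)"
    using z[of "Suc k"] by (intro eq_matI) (auto simp: algebra_simps)
  finally show ?case .
qed

text \<open>On powers of R(1), the operator integrates monomials; dividing by k+1 uses
  characteristic zero.\<close>

lemma rb_apply_one_pow:
  fixes R :: "'a::field_char_0 mat \<Rightarrow> 'a mat"
  assumes R: "rb_operator n R"
  shows "R (R (1\<^sub>m n) ^\<^sub>m k) = (1 / of_nat (Suc k)) \<cdot>\<^sub>m R (1\<^sub>m n) ^\<^sub>m Suc k"
proof -
  have z: "(R ^^ j) (1\<^sub>m n) \<in> carrier_mat n n" for j by (rule rb_operator_funpow_closed[OF R]) simp
  have "R (R (1\<^sub>m n) ^\<^sub>m k) = fact k \<cdot>\<^sub>m (R ^^ Suc k) (1\<^sub>m n)"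
    unfolding rb_one_pow[OF R] using rb_operator_smult[OF R z] by simp
  also have "\<dots> = (1 / of_nat (Suc k)) \<cdot>\<^sub>m R (1\<^sub>m n) ^\<^sub>m Suc k"
    unfolding rb_one_pow[OF R] using z[of "Suc k"]
    by (intro eq_matI) (auto simp del: funpow.simps of_nat_Suc simp: fact_Suc)
  finally show ?thesis .
qed

text \<open>Zero rows pad the system to a square one of size \<open>K\<close>. Row \<open>N\<close>
  is zero, so the determinant vanishes and the kernel is nontrivial.\<close>

lemma exists_linear_dependence:
  fixes f :: "nat \<Rightarrow> nat \<Rightarrow> 'a::field"
  assumes "N < K"
  shows "\<exists>v. (\<exists>k<K. v k \<noteq> 0) \<and> (\<forall>i<N. (\<Sum>k<K. v k * f k i) = 0)"
proof -
  define A where "A = mat K K (\<lambda>(i, k). if i < N then f k i else 0)"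
  have A: "A \<in> carrier_mat K K" by (simp add: A_def)
  have "transpose_mat A *\<^sub>v unit_vec K N = 0\<^sub>v K"
    using assms by (intro eq_vecI) (auto simp: A_def)
  moreover have "unit_vec K N \<noteq> (0\<^sub>v K :: 'a vec)"
    using assms by (metis index_unit_vec(1) index_zero_vec(1) zero_neq_one)
  ultimately have "det (transpose_mat A) = 0"
    using det_0_iff_vec_prod_zero_field[of "transpose_mat A" K] A
    by (metis transpose_carrier_mat unit_vec_carrier)
  then have "det A = 0" using det_transpose[OF A] by simp
  then obtain v where v: "v \<in> carrier_vec K" "v \<noteq> 0\<^sub>v K" "A *\<^sub>v v = 0\<^sub>v K"
    using det_0_iff_vec_prod_zero_field[OF A] by blast
  have "\<exists>k<K. v $ k \<noteq> 0" using v(1,2) by (metis carrier_vecD eq_vecI index_zero_vec(1,2))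
  moreover have "(\<Sum>k<K. v $ k * f k i) = 0" if "i < N" for i
  proof -
    have "(\<Sum>k<K. v $ k * f k i) = (A *\<^sub>v v) $ i"
      using that assms v(1) by (auto simp: A_def scalar_prod_def lessThan_atLeast0 mult.commute intro!: sum.cong)
    also have "\<dots> = 0" using v(3) that assms by simp
    finally show ?thesis .
  qed
  ultimately show ?thesis by blast
qed

text \<open>If \<open>a = R(1)\<close> is a root of \<open>f\<close>, applying \<open>R\<close> shows that it is also a root of
  the antiderivative of \<open>f\<close> vanishing at \<open>0\<close>. Comparing that antiderivative with \<open>X f\<close> eliminates a
  monomial, so a root of a polynomial with the fewest monomials is nilpotent.\<close>

lemma rb_one_nilpotent:
  fixes R :: "'a::field_char_0 mat \<Rightarrow> 'a mat"
  assumes R: "rb_operator n R"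
  shows "\<exists>d. R (1\<^sub>m n) ^\<^sub>m d = 0\<^sub>m n n"
proof -
  define a where "a = R (1\<^sub>m n)"
  have a: "a \<in> carrier_mat n n" by (simp add: a_def rb_operator_closed[OF R])
  \<comment> \<open>Induction on the number of monomials of the annihilating polynomial with
    coefficients \<open>c\<close>. Once a single monomial is left, a power of \<open>a\<close> is
    zero.\<close>
  have main: "\<exists>d. a ^\<^sub>m d = 0\<^sub>m n n"
    if "\<exists>k<K. c k \<noteq> 0" "\<And>i j. i < n \<Longrightarrow> j < n \<Longrightarrow> (\<Sum>k<K. c k * (a ^\<^sub>m k) $$ (i, j)) = 0" for K c
    using that
  proof (induction "card {k. k < K \<and> c k \<noteq> 0}" arbitrary: K c rule: less_induct)
    case less
    obtain d where d: "d < K" "c d \<noteq> 0" using less.prems by blast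
    show ?case
    proof (cases "\<exists>k<K. k \<noteq> d \<and> c k \<noteq> 0")
      case False
      have "(a ^\<^sub>m d) $$ (i, j) = 0" if "i < n" "j < n" for i j
      proof -
        have "(\<Sum>k<K. c k * (a ^\<^sub>m k) $$ (i, j)) = (\<Sum>k<K. if k = d then c d * (a ^\<^sub>m d) $$ (i, j) else 0)"
          using False by (intro sum.cong) auto
        then show ?thesis using less.prems(2)[OF that] d by simp
      qed
      then have "a ^\<^sub>m d = 0\<^sub>m n n" using a by (intro eq_matI) auto
      then show ?thesis by blast
    next
      case True
      then obtain e where e: "e < K" "e \<noteq> d" "c e \<noteq> 0" by blast
      \<comment> \<open>Coefficients of the antiderivative of f minus X f / (d+1): the monomial
        coming from X^d cancels, and all others keep nonzero coefficients.\<close>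
      define c' where "c' k = (case k of 0 \<Rightarrow> 0 | Suc k \<Rightarrow> c k * (1 / of_nat (Suc k) - 1 / of_nat (Suc d)))" for k
      have c'_Suc: "c' (Suc k) = c k * (1 / of_nat (Suc k) - 1 / of_nat (Suc d))" for k
        by (simp add: c'_def)
      have nz: "c' (Suc k) \<noteq> 0 \<longleftrightarrow> c k \<noteq> 0 \<and> k \<noteq> d" for k
        unfolding c'_Suc by (auto simp del: of_nat_Suc)
      have supp: "{k. k < Suc K \<and> c' k \<noteq> 0} = Suc ` ({k. k < K \<and> c k \<noteq> 0} - {d})"
      proof (rule Set.set_eqI)
        fix k show "k \<in> {k. k < Suc K \<and> c' k \<noteq> 0} \<longleftrightarrow> k \<in> Suc ` ({k. k < K \<and> c k \<noteq> 0} - {d})"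
          by (cases k) (auto simp: nz, simp add: c'_def)
      qed
      have "card {k. k < Suc K \<and> c' k \<noteq> 0} < card {k. k < K \<and> c k \<noteq> 0}"
        unfolding supp using d
        by (subst card_image) (auto intro!: card_Diff1_less simp del: card_Diff_insert)
      moreover have "\<exists>k<Suc K. c' k \<noteq> 0" using e nz[of e] by (intro exI[of _ "Suc e"]) simp
      moreover have "(\<Sum>k<Suc K. c' k * (a ^\<^sub>m k) $$ (i, j)) = 0" if ij: "i < n" "j < n" for i j
      proof -
        \<comment> \<open>\<open>X\<close> is f(a), written entrywise. Expanding R(X) = 0 gives the
          relation for the antiderivative.\<close>
        define X where "X = mat n n (\<lambda>(i, j). \<Sum>k<K. c k * (a ^\<^sub>m k) $$ (i, j))"
        have X: "X = 0\<^sub>m n n" using less.prems(2) by (intro eq_matI) (auto simp: X_def)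
        have "(\<Sum>k<K. c k * (a ^\<^sub>m Suc k) $$ (i, j)) = (\<Sum>k<K. \<Sum>m<n. c k * ((a ^\<^sub>m k) $$ (i, m) * a $$ (m, j)))"
          using index_mult_mat_sum[OF pow_carrier_mat[OF a] a ij] by (simp add: sum_distrib_left)
        also have "\<dots> = (\<Sum>m<n. (\<Sum>k<K. c k * (a ^\<^sub>m k) $$ (i, m)) * a $$ (m, j))"
          by (subst sum.swap) (simp add: sum_distrib_right mult.assoc)
        also have "\<dots> = 0" using less.prems(2)[OF ij(1)] by simp
        finally have 1: "(\<Sum>k<K. c k * (a ^\<^sub>m Suc k) $$ (i, j)) = 0" .
        have "(\<Sum>k<K. c k * (1 / of_nat (Suc k)) * (a ^\<^sub>m Suc k) $$ (i, j)) = (\<Sum>k<K. c k * R (a ^\<^sub>m k) $$ (i, j))"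
          unfolding a_def rb_apply_one_pow[OF R] using a[unfolded a_def] ij
          by (intro sum.cong) (simp_all del: pow_mat.simps of_nat_Suc)
        also have "\<dots> = (\<Sum>k<K. \<Sum>p<n. \<Sum>q<n. c k * ((a ^\<^sub>m k) $$ (p, q) * R (mat_unit n p q) $$ (i, j)))"
          using rb_operator_index[OF R pow_carrier_mat[OF a] ij] by (simp add: sum_distrib_left)
        also have "\<dots> = (\<Sum>p<n. \<Sum>k<K. \<Sum>q<n. c k * ((a ^\<^sub>m k) $$ (p, q) * R (mat_unit n p q) $$ (i, j)))"
          by (rule sum.swap)
        also have "\<dots> = (\<Sum>p<n. \<Sum>q<n. \<Sum>k<K. c k * ((a ^\<^sub>m k) $$ (p, q) * R (mat_unit n p q) $$ (i, j)))"
          by (intro sum.cong refl sum.swap)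
        also have "\<dots> = (\<Sum>p<n. \<Sum>q<n. X $$ (p, q) * R (mat_unit n p q) $$ (i, j))"
          by (intro sum.cong refl) (simp add: X_def sum_distrib_right mult.assoc)
        also have "\<dots> = 0" by (intro sum.neutral ballI) (simp add: X)
        finally have 2: "(\<Sum>k<K. c k * (1 / of_nat (Suc k)) * (a ^\<^sub>m Suc k) $$ (i, j)) = 0" .
        have "(\<Sum>k<Suc K. c' k * (a ^\<^sub>m k) $$ (i, j)) = (\<Sum>k<K. c' (Suc k) * (a ^\<^sub>m Suc k) $$ (i, j))"
          by (subst sum.lessThan_Suc_shift) (simp add: c'_def)
        also have "\<dots> = (\<Sum>k<K. c k * (1 / of_nat (Suc k)) * (a ^\<^sub>m Suc k) $$ (i, j))
            - (1 / of_nat (Suc d)) * (\<Sum>k<K. c k * (a ^\<^sub>m Suc k) $$ (i, j))"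
          unfolding c'_Suc sum_distrib_left sum_subtractf[symmetric]
          by (intro sum.cong refl) (simp add: algebra_simps del: of_nat_Suc pow_mat.simps)
        finally show ?thesis unfolding 1 2 by simp
      qed
      ultimately show ?thesis by (rule less.hyps)
    qed
  qed
  \<comment> \<open>The first annihilating polynomial: \<open>n * n + 1\<close> powers of
    \<open>a\<close>, flattened to vectors with \<open>n * n\<close> coordinates, are
    dependent.\<close>
  obtain v where v: "\<exists>k<Suc (n * n). v k \<noteq> 0"
    "\<And>i. i < n * n \<Longrightarrow> (\<Sum>k<Suc (n * n). v k * (a ^\<^sub>m k) $$ (i div n, i mod n)) = 0"
    using exists_linear_dependence[of "n * n" "Suc (n * n)" "\<lambda>k i. (a ^\<^sub>m k) $$ (i div n, i mod n)"] by blast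
  have "(\<Sum>k<Suc (n * n). v k * (a ^\<^sub>m k) $$ (i, j)) = 0" if "i < n" "j < n" for i j
  proof -
    have "i * n + j < n * n"
    proof -
      have "i * n + j < Suc i * n" using that by simp
      also have "\<dots> \<le> n * n" using that by (intro mult_le_mono1) simp
      finally show ?thesis .
    qed
    from v(2)[OF this] show ?thesis using that by simp
  qed
  from main[OF v(1) this] show ?thesis unfolding a_def by blast
qed

text \<open>Applying a^(M-k) to the relation kills the terms beyond \<open>k\<close>, and those
  before \<open>k\<close> vanish by induction. Row \<open>i0\<close> then leaves \<open>v k\<close>
  times a nonzero entry of a^M.\<close>

lemma krylov_independent:
  fixes a :: "'a::field mat"
  assumes a: "a \<in> carrier_mat n n" and nil: "a ^\<^sub>m Suc M = 0\<^sub>m n n"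
    and i0: "i0 < n" and j: "j < n" and ne: "(a ^\<^sub>m M) $$ (i0, j) \<noteq> 0"
    and K: "K \<le> Suc M" and dep: "\<And>i. i < n \<Longrightarrow> (\<Sum>k<K. v k * (a ^\<^sub>m k) $$ (i, j)) = 0"
    and k: "k < K"
  shows "v k = 0"
  using k
proof (induction k rule: less_induct)
  case (less k)
  let ?e = "M - k"
  have zero: "(a ^\<^sub>m e) $$ (i0, j) = 0" if "Suc M \<le> e" for e
  proof -
    have "a ^\<^sub>m e = a ^\<^sub>m (Suc M + (e - Suc M))" using that by simp
    also have "\<dots> = 0\<^sub>m n n * a ^\<^sub>m (e - Suc M)" unfolding pow_mat_add[OF a] nil ..
    also have "\<dots> = 0\<^sub>m n n" using a by simp
    finally show ?thesis using i0 j by simp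
  qed
  have "0 = (\<Sum>m<n. (a ^\<^sub>m ?e) $$ (i0, m) * (\<Sum>l<K. v l * (a ^\<^sub>m l) $$ (m, j)))"
    using dep by simp
  also have "\<dots> = (\<Sum>l<K. v l * (\<Sum>m<n. (a ^\<^sub>m ?e) $$ (i0, m) * (a ^\<^sub>m l) $$ (m, j)))"
    unfolding sum_distrib_left by (subst sum.swap) (simp add: mult.left_commute)
  also have "\<dots> = (\<Sum>l<K. v l * (a ^\<^sub>m (?e + l)) $$ (i0, j))"
    using index_mult_mat_sum[OF pow_carrier_mat[OF a] pow_carrier_mat[OF a] i0 j]
    by (simp add: pow_mat_add[OF a])
  also have "\<dots> = (\<Sum>l<K. if l = k then v k * (a ^\<^sub>m M) $$ (i0, j) else 0)"
  proof (rule sum.cong[OF refl])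
    fix l assume "l \<in> {..<K}"
    then show "v l * (a ^\<^sub>m (?e + l)) $$ (i0, j) = (if l = k then v k * (a ^\<^sub>m M) $$ (i0, j) else 0)"
      using less K zero[of "?e + l"] by (cases l k rule: linorder_cases) auto
  qed
  finally show ?case using less.prems ne by simp
qed

lemma mat_nonzero_index:
  assumes "A \<in> carrier_mat n m" "A \<noteq> 0\<^sub>m n m"
  shows "\<exists>i<n. \<exists>j<m. A $$ (i, j) \<noteq> 0"
proof (rule ccontr)
  assume "\<not> ?thesis"
  then have "A = 0\<^sub>m n m" using assms(1) by (intro eq_matI) auto
  then show False using assms(2) by simp
qed

text \<open>If the least annihilating exponent exceeded \<open>n\<close>, one fixed column of a^0,
  ..., a^n would give n+1 independent vectors with n coordinates.\<close>

lemma nilpotent_pow_dim: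
  fixes a :: "'a::field mat"
  assumes a: "a \<in> carrier_mat n n" and "a ^\<^sub>m d = 0\<^sub>m n n"
  shows "a ^\<^sub>m n = 0\<^sub>m n n"
proof -
  define D where "D = (LEAST d. a ^\<^sub>m d = 0\<^sub>m n n)"
  have D: "a ^\<^sub>m D = 0\<^sub>m n n" unfolding D_def by (rule LeastI) (rule assms(2))
  have "D \<le> n"
  proof (rule ccontr)
    assume "\<not> D \<le> n"
    then obtain M where M: "D = Suc M" "n \<le> M" by (cases D) auto
    have "a ^\<^sub>m M \<noteq> 0\<^sub>m n n" using not_less_Least[of M "\<lambda>d. a ^\<^sub>m d = 0\<^sub>m n n"] M unfolding D_def by simp
    then obtain i j where ij: "i < n" "j < n" "(a ^\<^sub>m M) $$ (i, j) \<noteq> 0"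
      using mat_nonzero_index[OF pow_carrier_mat[OF a]] by blast
    obtain v where v: "\<exists>k<Suc n. v k \<noteq> 0" "\<And>i. i < n \<Longrightarrow> (\<Sum>k<Suc n. v k * (a ^\<^sub>m k) $$ (i, j)) = 0"
      using exists_linear_dependence[of n "Suc n" "\<lambda>k i. (a ^\<^sub>m k) $$ (i, j)"] by blast
    have "v k = 0" if "k < Suc n" for k
      using krylov_independent[OF a D[unfolded M(1)] ij _ v(2) that] M by simp
    then show False using v(1) by blast
  qed
  then have "a ^\<^sub>m n = a ^\<^sub>m D * a ^\<^sub>m (n - D)" using pow_mat_add[OF a, of D "n - D"] by simp
  then show ?thesis using a by (simp add: D)
qed

lemma rb_one_pow_dim:
  fixes R :: "'a::field_char_0 mat \<Rightarrow> 'a mat"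
  assumes R: "rb_operator n R"
  shows "R (1\<^sub>m n) ^\<^sub>m n = 0\<^sub>m n n"
  using nilpotent_pow_dim[OF rb_operator_closed[OF R one_carrier_mat]] rb_one_nilpotent[OF R] by blast

text \<open>The hypothesis on row \<open>i\<close> makes \<open>c\<close> an eigenvalue of R(1),
  which is nilpotent. This is the source of the contradiction in the regular case.\<close>

lemma rb_const_unit_row_eq_0:
  fixes r :: "nat \<Rightarrow> nat \<Rightarrow> nat \<Rightarrow> nat \<Rightarrow> 'a::field_char_0"
  assumes rb: "rb_const n r" and i: "i < n"
    and row: "\<And>j. j < n \<Longrightarrow> (\<Sum>p<n. r p p i j) = (if i = j then c else 0)"
  shows "c = 0"
proof -
  define a where "a = op_of_const n r (1\<^sub>m n)"
  have a: "a \<in> carrier_mat n n" by (simp add: a_def)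
  have ai: "a $$ (i, j) = (if i = j then c else 0)" if j: "j < n" for j
  proof -
    have "a $$ (i, j) = (\<Sum>p<n. \<Sum>q<n. if q = p then r p p i j else 0)"
      unfolding a_def op_of_const_index[OF i j] by (intro sum.cong refl) auto
    also have "\<dots> = (\<Sum>p<n. r p p i j)" by simp
    finally show ?thesis using row[OF j] by simp
  qed
  have "(a ^\<^sub>m k) $$ (i, j) = (if i = j then c ^ k else 0)" if "j < n" for j k
    using that
  proof (induction k arbitrary: j)
    case 0
    then show ?case using a i by simp
  next
    case (Suc k)
    have "(a ^\<^sub>m Suc k) $$ (i, j) = (\<Sum>m<n. if m = i then c ^ k * a $$ (i, j) else 0)"
      unfolding pow_mat.simps index_mult_mat_sum[OF pow_carrier_mat[OF a] a i Suc.prems]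
      using Suc.IH by (intro sum.cong) auto
    then show ?case using i Suc.prems by (simp add: ai)
  qed
  from this[of i n] have "c ^ n = 0"
    using rb_one_pow_dim[OF rb_operator_op_of_const[OF rb]] i unfolding a_def by simp
  then show ?thesis by simp
qed

section \<open>The regular nilpotent case\<close>

lemma sum_lessThan_split:
  fixes f :: "nat \<Rightarrow> 'a::comm_monoid_add"
  assumes "l \<le> n" "\<And>m. l \<le> m \<Longrightarrow> m < n \<Longrightarrow> f m = 0"
  shows "(\<Sum>m<n. f m) = (\<Sum>m<l. f m)"
  using assms by (intro sum.mono_neutral_right) auto

text \<open>Written in entries with indices from \<open>0\<close>, \<open>com\<close> is R(Jx - xJ)
  = J R(x) - R(x) J for the shift J. A nonzero \<open>lam\<close> would produce an induced operator
  whose value at the identity has a nonzero eigenvalue.\<close>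

lemma rb_const_shift_corner_eq_0:
  fixes r :: "nat \<Rightarrow> nat \<Rightarrow> nat \<Rightarrow> nat \<Rightarrow> 'a::field_char_0"
  assumes n: "n \<ge> 1" and rb: "rb_const n r"
    and com: "\<And>p q i j. p < n \<Longrightarrow> q < n \<Longrightarrow> i < n \<Longrightarrow> j < n \<Longrightarrow>
      (if p = 0 then 0 else r (p - 1) q i j) - (if Suc q < n then r p (Suc q) i j else 0) =
      (if Suc i < n then r p q (Suc i) j else 0) - (if j = 0 then 0 else r p q i (j - 1))"
    and top: "\<And>k j. k < n \<Longrightarrow> j < n \<Longrightarrow>
      r 0 k (n - 1) j = (if k = 0 \<and> j = n - 1 then lam else 0)"
  shows "lam = 0"
proof (rule ccontr)
  assume lam: "lam \<noteq> 0"
  \<comment> \<open>Since all columns \<open>j\<close> are covered, this also says that the span E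
    of the first \<open>l\<close> unit vectors is invariant. \<open>A (n - 1)\<close> is the
    hypothesis \<open>top\<close>, so the least \<open>l\<close> leaves V/E nonzero.\<close>
  define A where "A l \<longleftrightarrow> (\<forall>k<n. \<forall>i<n. \<forall>j<n. l \<le> i \<longrightarrow>
    r 0 k i j = (if k = 0 \<and> i = j then lam else 0))" for l
  have A_top: "A (n - 1)"
    unfolding A_def
  proof (intro allI impI)
    fix k i j assume *: "k < n" "i < n" "j < n" "n - 1 \<le> i"
    then have "i = n - 1" by simp
    then show "r 0 k i j = (if k = 0 \<and> i = j then lam else 0)"
      using top[of k j] * by auto
  qed
  define l where "l = (LEAST l. A l)"
  have Al: "A l" unfolding l_def using A_top by (rule LeastI)
  have "l \<le> n - 1" unfolding l_def using A_top by (rule Least_le)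
  then have ln: "l < n" using n by simp
  have T: "r 0 k i j = (if k = 0 \<and> i = j then lam else 0)"
    if "k < n" "i < n" "j < n" "l \<le> i" for k i j
    using Al that unfolding A_def by blast
  \<comment> \<open>For \<open>l = 0\<close>, R(E_00) would be \<open>lam\<close> times the
    identity, and entry (0, 0) of its square would equal both lam^2 and 2 lam^2.\<close>
  have l0: "l \<noteq> 0"
  proof
    assume "l = 0"
    then have T': "r 0 k i j = (if k = 0 \<and> i = j then lam else 0)" if "k < n" "i < n" "j < n" for k i j
      using T that by simp
    have e1: "(\<Sum>m<n. r 0 0 0 m * r 0 0 m 0) = (\<Sum>m<n. if m = 0 then lam * lam else 0)"
      using n by (intro sum.cong) (auto simp: T')
    have e2: "(\<Sum>m<n. r 0 0 m 0 * r m 0 0 0) = (\<Sum>m<n. if m = 0 then lam * lam else 0)"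
      using n by (intro sum.cong) (auto simp: T')
    have e3: "(\<Sum>m<n. r 0 0 0 m * r 0 m 0 0) = (\<Sum>m<n. if m = 0 then lam * lam else 0)"
      using n by (intro sum.cong) (auto simp: T')
    have "(\<Sum>m<n. if m = 0 then lam * lam else 0) = lam * lam" using n by (simp add: sum.delta)
    then have "lam * lam = lam * lam + lam * lam"
      using rb_constD[OF rb, of 0 0 0 0 0 0] n unfolding e1 e2 e3 by simp
    then show False using lam by simp
  qed
  have "\<not> A (l - 1)" using not_less_Least[of "l - 1" A] l0 unfolding l_def by simp
  then obtain k0 i0 j0 where ij: "k0 < n" "i0 < n" "j0 < n" "l - 1 \<le> i0"
    and ne: "r 0 k0 i0 j0 \<noteq> (if k0 = 0 \<and> i0 = j0 then lam else 0)"
    unfolding A_def by blast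
  have "i0 = l - 1" using T[of k0 i0 j0] ij ne by fastforce
  \<comment> \<open>Column \<open>j0\<close> of R(E_0k0), with \<open>lam\<close> removed from the
    diagonal if \<open>k0 = 0\<close>. Beyond E the true column is zero by \<open>T\<close>; at
    \<open>l - 1\<close> it is nonzero by failure of \<open>A (l - 1)\<close>.\<close>
  define f where "f m = (if m < l then r 0 k0 m j0 - (if k0 = 0 \<and> m = j0 then lam else 0) else 0)" for m
  have f_ge: "f m = 0" if "l \<le> m" for m using that by (simp add: f_def)
  have f_top: "f (l - 1) \<noteq> 0" using ne \<open>i0 = l - 1\<close> l0 by (simp add: f_def)
  \<comment> \<open>\<open>D g\<close>: modulo the span \<open>E\<close> of the first \<open>l\<close> unit vectors, the image of every rank one matrix
    with column \<open>g\<close> acts as a scalar. Minimality of \<open>l\<close> provides such a \<open>g\<close> of height exactly \<open>l\<close>,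
    and commuting with the shift then gives all of \<open>E\<close>.\<close>
  define D where "D g \<longleftrightarrow> (\<forall>m\<ge>l. g m = 0) \<and> (\<forall>q<n. \<exists>\<mu>. \<forall>i<n. \<forall>j<n. l \<le> i \<longrightarrow>
    (\<Sum>m<n. g m * r m q i j) = (if i = j then \<mu> else 0))" for g :: "nat \<Rightarrow> 'a"
  \<comment> \<open>Read the Rota--Baxter identity at E_0k0 and E_j0q on V/E. The diagonal
    correction in \<open>f\<close> cancels the product of the images, and E_0k0 R(E_j0q) lies in row
    0, where R is known to act as a scalar.\<close>
  have Df: "D f"
  proof -
    have "(\<Sum>m<n. f m * r m q i j) = (if i = j then - lam * r j0 q k0 0 else 0)"
      if *: "q < n" "i < n" "j < n" "l \<le> i" for q i j
    proof -
      have e1: "(\<Sum>m<n. r 0 k0 i m * r j0 q m j) = (\<Sum>m<n. if m = i then (if k0 = 0 then lam * r j0 q i j else 0) else 0)"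
        using * ij by (intro sum.cong) (auto simp: T)
      have e3: "(\<Sum>m<n. r j0 q k0 m * r 0 m i j) = (\<Sum>m<n. if m = 0 then (if i = j then r j0 q k0 0 * lam else 0) else 0)"
        using * ij by (intro sum.cong) (auto simp: T)
      have "(\<Sum>m<n. f m * r m q i j) =
          (\<Sum>m<n. (r 0 k0 m j0 - (if k0 = 0 \<and> m = j0 then lam else 0)) * r m q i j)"
        using * ij by (intro sum.cong) (auto simp: f_def T)
      also have "\<dots> = (\<Sum>m<n. r 0 k0 m j0 * r m q i j)
          - (\<Sum>m<n. if m = j0 then (if k0 = 0 then lam * r j0 q i j else 0) else 0)"
        unfolding sum_subtractf[symmetric] by (intro sum.cong) (auto simp: algebra_simps)
      also have "(\<Sum>m<n. r 0 k0 m j0 * r m q i j) =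
          (if k0 = 0 then lam * r j0 q i j else 0) - (if i = j then r j0 q k0 0 * lam else 0)"
        using rb_constD[OF rb, of 0 k0 j0 q i j] * ij n unfolding e1 e3 by (simp add: sum.delta)
      finally show ?thesis using ij by (simp add: sum.delta)
    qed
    then show ?thesis unfolding D_def using f_ge by blast
  qed
  \<comment> \<open>If x has \<open>g\<close> as column \<open>q\<close> and zeros elsewhere, then
    R(Jx) = R(xJ) + J R(x) - R(x) J. On V/E the bracket of J with a scalar vanishes. Here xJ has
    \<open>g\<close> as column \<open>q + 1\<close>, or is zero when \<open>q\<close> is
    last.\<close>
  have Dshift: "D (\<lambda>m. g (Suc m))" if Dg: "D g" for g
  proof -
    have g0: "g m = 0" if "l \<le> m" for m using Dg that unfolding D_def by blast
    have "\<exists>\<mu>. \<forall>i<n. \<forall>j<n. l \<le> i \<longrightarrow>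
      (\<Sum>m<n. g (Suc m) * r m q i j) = (if i = j then \<mu> else 0)" if q: "q < n" for q
    proof -
      obtain \<mu> where \<mu>: "\<And>i j. i < n \<Longrightarrow> j < n \<Longrightarrow> l \<le> i \<Longrightarrow>
          (\<Sum>m<n. g m * r m q i j) = (if i = j then \<mu> else 0)"
        using Dg q unfolding D_def by blast
      have "\<exists>\<mu>'. \<forall>i<n. \<forall>j<n. l \<le> i \<longrightarrow>
          (\<Sum>m<n. g m * (if Suc q < n then r m (Suc q) i j else 0)) = (if i = j then \<mu>' else 0)"
      proof (cases "Suc q < n")
        case True
        then show ?thesis using Dg unfolding D_def by simp
      next
        case False
        then show ?thesis by (intro exI[of _ 0]) simp
      qed
      then obtain \<mu>' where \<mu>': "\<And>i j. i < n \<Longrightarrow> j < n \<Longrightarrow> l \<le> i \<Longrightarrow>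
          (\<Sum>m<n. g m * (if Suc q < n then r m (Suc q) i j else 0)) = (if i = j then \<mu>' else 0)"
        by blast
      have "(\<Sum>m<n. g (Suc m) * r m q i j) = (if i = j then \<mu>' else 0)"
        if *: "i < n" "j < n" "l \<le> i" for i j
      proof -
        have "(\<Sum>m<n. g (Suc m) * r m q i j) = (\<Sum>m<n-1. g (Suc m) * r m q i j)"
          by (rule sum_lessThan_split) (use ln in \<open>auto intro!: g0\<close>)
        also have "\<dots> = (\<Sum>m<Suc (n-1). g m * (if m = 0 then 0 else r (m - 1) q i j))"
          by (subst sum.lessThan_Suc_shift) simp
        also have "\<dots> = (\<Sum>m<n. g m * (if m = 0 then 0 else r (m - 1) q i j))"
          using n by simp
        also have "\<dots> = (\<Sum>m<n. g m * (if Suc q < n then r m (Suc q) i j else 0)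
            + (if Suc i < n then g m * r m q (Suc i) j else 0)
            - (if j = 0 then 0 else g m * r m q i (j - 1)))"
        proof (rule sum.cong[OF refl])
          fix m assume m: "m \<in> {..<n}"
          have "(if m = 0 then 0 else r (m - 1) q i j) = (if Suc q < n then r m (Suc q) i j else 0)
            + (if Suc i < n then r m q (Suc i) j else 0) - (if j = 0 then 0 else r m q i (j - 1))"
            using com[of m q i j] m q * by (simp add: algebra_simps)
          then show "g m * (if m = 0 then 0 else r (m - 1) q i j) =
            g m * (if Suc q < n then r m (Suc q) i j else 0)
            + (if Suc i < n then g m * r m q (Suc i) j else 0)
            - (if j = 0 then 0 else g m * r m q i (j - 1))"
            by (simp only:) (simp add: algebra_simps)
        qed
        also have "\<dots> = (\<Sum>m<n. g m * (if Suc q < n then r m (Suc q) i j else 0))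
            + (if Suc i < n then \<Sum>m<n. g m * r m q (Suc i) j else 0)
            - (if j = 0 then 0 else \<Sum>m<n. g m * r m q i (j - 1))"
          by (simp add: sum_subtractf sum.distrib)
        also have "\<dots> = (if i = j then \<mu>' else 0)"
          using * \<mu>'[of i j] \<mu>[of "Suc i" j] \<mu>[of i "j - 1"] by auto
        finally show ?thesis .
      qed
      then show ?thesis by blast
    qed
    then show ?thesis unfolding D_def using g0 by simp
  qed
  have Dfs: "D (\<lambda>m. f (m + t))" for t
  proof (induction t)
    case (Suc t)
    then show ?case using Dshift[of "\<lambda>m. f (m + t)"] by simp
  qed (use Df in simp)
  have basis: "\<exists>\<mu>. \<forall>i<n. \<forall>j<n. l \<le> i \<longrightarrow> r p q i j = (if i = j then \<mu> else 0)"
    if "p < l" "q < n" for p q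
    using that
  proof (induction p rule: less_induct)
    case (less p)
    \<comment> \<open>This shift places the last nonzero coordinate at \<open>p\<close>. The system
      is triangular: removing the contributions of the earlier unit vectors isolates E_pq.\<close>
    define g where "g m = f (m + (l - 1 - p))" for m
    have gp: "g p \<noteq> 0" using f_top less.prems by (simp add: g_def)
    have g0: "g m = 0" if "p < m" for m unfolding g_def using that less.prems by (intro f_ge) simp
    have "D g" unfolding g_def by (rule Dfs)
    then obtain \<mu> where \<mu>: "\<And>i j. i < n \<Longrightarrow> j < n \<Longrightarrow> l \<le> i \<Longrightarrow>
        (\<Sum>m<n. g m * r m q i j) = (if i = j then \<mu> else 0)"
      using less.prems unfolding D_def by blast
    have "\<forall>m. \<exists>\<nu>. m < p \<longrightarrow> (\<forall>i<n. \<forall>j<n. l \<le> i \<longrightarrow> r m q i j = (if i = j then \<nu> else 0))"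
      using less by (meson less_trans)
    then obtain \<nu> where \<nu>: "\<And>m i j. m < p \<Longrightarrow> i < n \<Longrightarrow> j < n \<Longrightarrow> l \<le> i \<Longrightarrow>
        r m q i j = (if i = j then \<nu> m else 0)"
      by metis
    have "r p q i j = (if i = j then (\<mu> - (\<Sum>m<p. g m * \<nu> m)) / g p else 0)"
      if *: "i < n" "j < n" "l \<le> i" for i j
    proof -
      have "(\<Sum>m<n. g m * r m q i j) = (\<Sum>m<Suc p. g m * r m q i j)"
        by (rule sum_lessThan_split) (use less.prems ln g0 in auto)
      also have "\<dots> = (\<Sum>m<p. if i = j then g m * \<nu> m else 0) + g p * r p q i j"
        using * by (auto intro!: sum.cong simp: \<nu>)
      finally have "g p * r p q i j = (if i = j then \<mu> - (\<Sum>m<p. g m * \<nu> m) else 0)"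
        using \<mu>[OF *] by (auto simp: algebra_simps)
      then show ?thesis using gp by (auto simp: field_simps)
    qed
    then show ?case by blast
  qed
  \<comment> \<open>For \<open>p < l\<close>, the scalar by which R(E_pq) acts on V/E; the last
    diagonal position lies outside E because \<open>l < n\<close>.\<close>
  define nu where "nu p q = r p q (n - 1) (n - 1)" for p q
  have low: "r p q i j = (if i = j then nu p q else 0)"
    if pq: "p < l" "q < n" and ij': "i < n" "j < n" "l \<le> i" for p q i j
  proof -
    obtain \<mu> where \<mu>: "\<And>i j. i < n \<Longrightarrow> j < n \<Longrightarrow> l \<le> i \<Longrightarrow> r p q i j = (if i = j then \<mu> else 0)"
      using basis[OF pq] by blast
    have "nu p q = \<mu>" unfolding nu_def using \<mu>[of "n - 1" "n - 1"] ln by simp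
    then show ?thesis using \<mu> ij' by simp
  qed
  \<comment> \<open>Corner entry of \<open>com\<close>: the one remaining term is off-diagonal in
    the last row, hence zero by \<open>low\<close>.\<close>
  have nu_Suc: "nu (Suc p) (Suc q) = nu p q" if "Suc p < l" "Suc q < n" for p q
  proof -
    have "n - 1 \<noteq> n - 1 - 1" "n - 1 \<noteq> 0" using that by simp_all
    moreover from this have "r (Suc p) q (n - 1) (n - 1 - 1) = 0"
      using low[of "Suc p" q "n - 1" "n - 1 - 1"] that ln by simp
    ultimately show ?thesis
      using com[of "Suc p" q "n - 1" "n - 1"] that ln by (simp add: nu_def)
  qed
  \<comment> \<open>Diagonals on or above the main one start in row 0, where \<open>top\<close>
    gives the value. As a matrix \<open>nu\<close> is thus lower triangular with diagonal
    \<open>lam\<close>.\<close>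
  have nu: "nu p q = (if p = q then lam else 0)" if "p < l" "p \<le> q" "q < n" for p q
    using that
  proof (induction p arbitrary: q)
    case 0
    then show ?case using top[of q "n - 1"] n by (auto simp: nu_def)
  next
    case (Suc p)
    then obtain q' where "q = Suc q'" by (cases q) auto
    then show ?case using Suc nu_Suc[of p q'] by auto
  qed
  \<comment> \<open>Corner entry of the Rota--Baxter identity: nu(R(x) y) + nu(x R(y)) = nu(x)
    nu(y). The first sum stops at \<open>l\<close> because the image of E_pq preserves E.\<close>
  have mid: "(\<Sum>m<l. r p q m s * nu m t) + (\<Sum>m<n. r s t q m * r p m (n-1) (n-1)) = nu p q * nu s t"
    if *: "p < l" "q < n" "s < l" "t < l" for p q s t
  proof -
    have "(\<Sum>m<n. r p q (n-1) m * r s t m (n-1)) = (\<Sum>m<n. if m = n - 1 then nu p q * nu s t else 0)"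
      using * ln by (intro sum.cong) (auto simp: low)
    moreover have "(\<Sum>m<n. r p q m s * r m t (n-1) (n-1)) = (\<Sum>m<l. r p q m s * r m t (n-1) (n-1))"
      by (rule sum_lessThan_split) (use * ln in \<open>auto simp: low\<close>)
    ultimately show ?thesis
      using rb_constD[OF rb, of p q s t "n-1" "n-1"] * ln by (simp add: sum.delta nu_def)
  qed
  \<comment> \<open>E_pq with p < l <= q kills E, and its image must do so too if R is to induce an
    operator on endomorphisms of E. In \<open>mid\<close> every term containing
    \<open>nu p q\<close> drops out, and the triangular \<open>nu\<close> with nonzero diagonal
    eliminates the entries from row \<open>l - 1\<close> upwards.\<close>
  have van: "r p q m s = 0" if *: "p < l" "l \<le> q" "q < n" "m < l" "s < l" for p q m s
    using \<open>m < l\<close>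
  proof (induction "l - m" arbitrary: m rule: less_induct)
    case less
    have IH: "r p q m' s = 0" if "m < m'" "m' < l" for m'
      using less that by simp
    have "(\<Sum>m'<n. r s m q m' * r p m' (n-1) (n-1)) = 0"
      using * less.prems ln by (intro sum.neutral) (auto simp: low nu nu_def[symmetric])
    then have "(\<Sum>m'<l. r p q m' s * nu m' m) = 0"
      using mid[of p q s m] * less.prems by (simp add: nu)
    also have "(\<Sum>m'<l. r p q m' s * nu m' m) = (\<Sum>m'<l. if m' = m then r p q m s * lam else 0)"
    proof (rule sum.cong[OF refl])
      fix m' assume m': "m' \<in> {..<l}"
      show "r p q m' s * nu m' m = (if m' = m then r p q m s * lam else 0)"
        using m' IH[of m'] nu[of m' m] less.prems ln by (cases m' m rule: linorder_cases) auto
    qed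
    finally show ?case using lam less.prems by (simp add: sum.delta)
  qed
  \<comment> \<open>The operator induced on the endomorphisms of \<open>E\<close>, recorded together with \<open>nu\<close>.\<close>
  define r' where "r' p q i j = (if p < l \<and> q < l \<and> (i < l \<longleftrightarrow> j < l) then r p q i j else 0)" for p q i j
  have rb': "rb_const n r'"
    unfolding rb_const_def
  proof (intro allI impI)
    fix p q s t i j
    assume b: "p < n" "q < n" "s < n" "t < n" "i < n" "j < n"
    show "(\<Sum>m<n. r' p q i m * r' s t m j) =
       (\<Sum>m<n. r' p q m s * r' m t i j) + (\<Sum>m<n. r' s t q m * r' p m i j)"
    proof (cases "p < l \<and> q < l \<and> s < l \<and> t < l \<and> (i < l \<longleftrightarrow> j < l)")
      case False
      have "(\<Sum>m<n. r' p q i m * r' s t m j) = 0"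
        using False by (intro sum.neutral) (auto simp: r'_def)
      moreover have "(\<Sum>m<n. r' p q m s * r' m t i j) = 0"
        using False by (intro sum.neutral) (auto simp: r'_def)
      moreover have "(\<Sum>m<n. r' s t q m * r' p m i j) = 0"
        using False by (intro sum.neutral) (auto simp: r'_def)
      ultimately show ?thesis by simp
    next
      case True
      \<comment> \<open>Each dropped product contains an entry of R in a row outside E and a column
        inside E, which is zero by \<open>low\<close>.\<close>
      have e1: "(\<Sum>m<n. r' p q i m * r' s t m j) = (\<Sum>m<n. r p q i m * r s t m j)"
        using True b by (intro sum.cong) (auto simp: r'_def low)
      have e2: "(\<Sum>m<n. r' p q m s * r' m t i j) = (\<Sum>m<n. r p q m s * r m t i j)"
        using True b by (intro sum.cong) (auto simp: r'_def low)
      \<comment> \<open>The terms with \<open>m\<close> outside E vanish by \<open>van\<close> in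
        the E-block and by \<open>nu p m = 0\<close> on V/E.\<close>
      have e3: "(\<Sum>m<n. r' s t q m * r' p m i j) = (\<Sum>m<n. r s t q m * r p m i j)"
      proof (rule sum.cong[OF refl])
        fix m assume m: "m \<in> {..<n}"
        show "r' s t q m * r' p m i j = r s t q m * r p m i j"
        proof (cases "m < l")
          case False
          then have "r p m i j = 0"
            using True b m by (cases "i < l") (auto simp: van low nu)
          then show ?thesis using False True by (auto simp: r'_def)
        qed (use True in \<open>auto simp: r'_def\<close>)
      qed
      show ?thesis unfolding e1 e2 e3 using rb_constD[OF rb] b by blast
    qed
  qed
  \<comment> \<open>Row \<open>l\<close> is the first one outside E; there the induced value at the
    identity is the sum of \<open>nu p p\<close> over E, a nonzero eigenvalue.\<close>
  have "(\<Sum>p<n. r' p p l j) = (if l = j then of_nat l * lam else 0)" if "j < n" for j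
  proof -
    have "(\<Sum>p<n. r' p p l j) = (\<Sum>p<l. r' p p l j)"
      by (rule sum_lessThan_split) (use ln in \<open>auto simp: r'_def\<close>)
    also have "\<dots> = (\<Sum>p<l. if l = j then lam else 0)"
      using that ln by (intro sum.cong) (auto simp: r'_def low nu)
    finally show ?thesis by simp
  qed
  from rb_const_unit_row_eq_0[OF rb' ln this] show False using l0 lam by simp
qed

section \<open>An operator of maximal nilpotency index\<close>

text \<open>Indexing each diagonal by the row, the operator takes partial sums and moves one diagonal up;
  the sums run from the top on and above the main diagonal, and from the bottom (with a minus sign)
  below it.\<close>

definition max_rb_const :: "nat \<Rightarrow> nat \<Rightarrow> nat \<Rightarrow> nat \<Rightarrow> 'a::comm_ring_1" where
  "max_rb_const p q i j =
    (if int j - int i = int q - int p + 1 then of_bool (p \<le> i) - of_bool (q < p) else 0)"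

text \<open>The diagonal conditions pin a summation index to an integer that may be negative or too
  large, hence the range test.\<close>

lemma sum_single_int:
  fixes c :: "'a::comm_monoid_add"
  shows "(\<Sum>m<n. if int m = z then c else 0) = (if 0 \<le> z \<and> z < int n then c else 0)"
proof (cases "0 \<le> z")
  case True
  then have "(\<Sum>m<n. if int m = z then c else 0) = (\<Sum>m<n. if m = nat z then c else 0)"
    by (intro sum.cong) auto
  then show ?thesis using True by (simp add: nat_less_iff)
qed auto

lemma rb_const_max_rb_const: "rb_const n (max_rb_const :: _ \<Rightarrow> _ \<Rightarrow> _ \<Rightarrow> _ \<Rightarrow> 'a::comm_ring_1)"
  unfolding rb_const_def
proof (intro allI impI)
  fix p q s t i j
  assume b: "p < n" "q < n" "s < n" "t < n" "i < n" "j < n"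
  let ?r = "max_rb_const :: _ \<Rightarrow> _ \<Rightarrow> _ \<Rightarrow> _ \<Rightarrow> 'a"
  \<comment> \<open>In each sum the diagonal conditions leave one index, \<open>z1\<close>,
    \<open>z2\<close> or \<open>z3\<close>, and the same condition \<open>H\<close>. What remains is
    a case check on integer inequalities.\<close>
  define z1 where "z1 = int i + int q - int p + 1"
  define z2 where "z2 = int s - int q + int p - 1"
  define z3 where "z3 = int q + int t - int s + 1"
  define H where "H \<longleftrightarrow> int j - int i = int q - int p + int t - int s + 2"
  let ?c1 = "if H then (of_bool (p \<le> i) - of_bool (q < p)) * (of_bool (int s \<le> z1) - of_bool (t < s)) else 0 :: 'a"
  let ?c2 = "if H then (of_bool (int p \<le> z2) - of_bool (q < p)) * (of_bool (z2 \<le> int i) - of_bool (int t < z2)) else 0 :: 'a"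
  let ?c3 = "if H then (of_bool (s \<le> q) - of_bool (t < s)) * (of_bool (p \<le> i) - of_bool (z3 < int p)) else 0 :: 'a"
  have "(\<Sum>m<n. ?r p q i m * ?r s t m j) = (\<Sum>m<n. if int m = z1 then ?c1 else 0)"
    by (intro sum.cong refl) (auto simp: max_rb_const_def z1_def H_def)
  moreover have "(\<Sum>m<n. ?r p q m s * ?r m t i j) = (\<Sum>m<n. if int m = z2 then ?c2 else 0)"
    by (intro sum.cong refl) (auto simp: max_rb_const_def z2_def H_def)
  moreover have "(\<Sum>m<n. ?r s t q m * ?r p m i j) = (\<Sum>m<n. if int m = z3 then ?c3 else 0)"
    by (intro sum.cong refl) (auto simp: max_rb_const_def z3_def H_def)
  moreover have "(if 0 \<le> z1 \<and> z1 < int n then ?c1 else 0) =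
      (if 0 \<le> z2 \<and> z2 < int n then ?c2 else 0) + (if 0 \<le> z3 \<and> z3 < int n then ?c3 else 0)"
    using b by (auto simp: z1_def z2_def z3_def H_def of_bool_def)
  ultimately show "(\<Sum>m<n. ?r p q i m * ?r s t m j) =
      (\<Sum>m<n. ?r p q m s * ?r m t i j) + (\<Sum>m<n. ?r s t q m * ?r p m i j)"
    unfolding sum_single_int by simp
qed

lemma op_of_const_mat_unit:
  assumes "p < n" "q < n" "i < n" "j < n"
  shows "op_of_const n r (mat_unit n p q) $$ (i, j) = r p q i j"
proof -
  have "op_of_const n r (mat_unit n p q) $$ (i, j) =
      (\<Sum>a<n. \<Sum>c<n. if c = q then (if a = p then r p q i j else 0) else 0)"
    unfolding op_of_const_index[OF assms(3,4)] by (intro sum.cong refl) auto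
  then show ?thesis using assms by simp
qed

text \<open>The unit in the lower left corner climbs the first column in \<open>n - 1\<close> steps,
  changing sign each time; \<open>n - 1\<close> more steps carry an entry along the first row to the
  upper right corner.\<close>

lemma max_rb_funpow_ne_0:
  assumes n: "n \<ge> 1"
  defines "R \<equiv> op_of_const n (max_rb_const :: _ \<Rightarrow> _ \<Rightarrow> _ \<Rightarrow> _ \<Rightarrow> 'a::field)"
  shows "(R ^^ (2 * n - 2)) (mat_unit n (n - 1) 0) \<noteq> 0\<^sub>m n n"
proof -
  have R: "rb_operator n R"
    unfolding R_def by (rule rb_operator_op_of_const[OF rb_const_max_rb_const])
  have col: "(R ^^ k) (mat_unit n (n - 1) 0) = (- 1) ^ k \<cdot>\<^sub>m mat_unit n (n - 1 - k) 0" if "k < n" for k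
    using that
  proof (induction k)
    case 0
    show ?case by (intro eq_matI) auto
  next
    case (Suc k)
    have "(R ^^ Suc k) (mat_unit n (n - 1) 0) = (- 1) ^ k \<cdot>\<^sub>m R (mat_unit n (n - 1 - k) 0)"
      using Suc rb_operator_smult[OF R mat_unit_carrier] by simp
    also have "R (mat_unit n (n - 1 - k) 0) = - 1 \<cdot>\<^sub>m mat_unit n (n - 1 - Suc k) 0"
    proof (rule eq_matI)
      fix i j assume "i < dim_row (- 1 \<cdot>\<^sub>m mat_unit n (n - 1 - Suc k) 0 :: 'a mat)"
        "j < dim_col (- 1 \<cdot>\<^sub>m mat_unit n (n - 1 - Suc k) 0 :: 'a mat)"
      then have ij: "i < n" "j < n" by simp_all
      show "R (mat_unit n (n - 1 - k) 0) $$ (i, j) = (- 1 \<cdot>\<^sub>m mat_unit n (n - 1 - Suc k) 0) $$ (i, j)"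
        using ij n Suc.prems unfolding R_def
        by (subst op_of_const_mat_unit) (auto simp: max_rb_const_def)
    qed (simp_all add: R_def op_of_const_def)
    finally show ?case by (intro eq_matI) (auto simp del: funpow.simps)
  qed
  \<comment> \<open>Other entries may appear on the same diagonal. Only the one in row 0 is
    followed, and the next row-0 entry depends on it alone.\<close>
  have row: "(R ^^ k) (mat_unit n 0 0) $$ (0, k) = 1" if "k < n" for k
    using that
  proof (induction k)
    case 0
    then show ?case by simp
  next
    case (Suc k)
    let ?x = "(R ^^ k) (mat_unit n 0 0)"
    have "R ?x $$ (0, Suc k) = (\<Sum>p<n. \<Sum>q<n. ?x $$ (p, q) * max_rb_const p q 0 (Suc k))"
      unfolding R_def using Suc.prems by simp
    also have "\<dots> = (\<Sum>p<n. \<Sum>q<n. if q = k then (if p = 0 then ?x $$ (0, k) else 0) else 0)"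
      by (intro sum.cong refl) (auto simp: max_rb_const_def)
    also have "\<dots> = ?x $$ (0, k)" using Suc.prems by simp
    finally show ?case using Suc by simp
  qed
  have two: "2 * n - 2 = (n - 1) + (n - 1)" using n by simp
  have "(R ^^ (2 * n - 2)) (mat_unit n (n - 1) 0) = (- 1) ^ (n - 1) \<cdot>\<^sub>m (R ^^ (n - 1)) (mat_unit n 0 0)"
    unfolding two funpow_add o_apply using n col[of "n - 1"] rb_operator_funpow_smult[OF R mat_unit_carrier]
    by simp
  then have "(R ^^ (2 * n - 2)) (mat_unit n (n - 1) 0) $$ (0, n - 1) = (- 1) ^ (n - 1)"
    using n row[of "n - 1"] rb_operator_funpow_closed[OF R mat_unit_carrier, of "n - 1" 0 0] by simp
  then show ?thesis using n by auto
qed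

section \<open>The upper bound\<close>

lemma conj_mat_mult:
  fixes P Q :: "'a::comm_ring_1 mat"
  assumes c: "P \<in> carrier_mat n n" "Q \<in> carrier_mat n n" and QP: "Q * P = 1\<^sub>m n"
    and x: "x \<in> carrier_mat n n" and y: "y \<in> carrier_mat n n"
  shows "P * (x * y) * Q = (P * x * Q) * (P * y * Q)"
proof -
  have "(P * x * Q) * (P * y * Q) = P * x * (Q * (P * (y * Q)))"
    using c x y by (simp add: assoc_mult_mat[of _ n n _ n _ n])
  also have "Q * (P * (y * Q)) = (Q * P) * (y * Q)"
    using c y by (simp add: assoc_mult_mat[of _ n n _ n _ n])
  also have "P * x * ((Q * P) * (y * Q)) = P * (x * y) * Q"
    using c x y by (simp add: QP assoc_mult_mat[of _ n n _ n _ n])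
  finally show ?thesis by simp
qed

lemma conj_mat_inverse:
  fixes P Q :: "'a::comm_ring_1 mat"
  assumes c: "P \<in> carrier_mat n n" "Q \<in> carrier_mat n n" and QP: "Q * P = 1\<^sub>m n"
    and x: "x \<in> carrier_mat n n"
  shows "Q * (P * x * Q) * P = x"
proof -
  have "Q * (P * x * Q) * P = (Q * P) * (x * (Q * P))"
    using c x by (simp add: assoc_mult_mat[of _ n n _ n _ n])
  then show ?thesis using x by (simp add: QP)
qed

text \<open>Conjugation is an algebra automorphism. Transporting R along it replaces R(1) by Q R(1)
  P, which can then be put in normal form.\<close>

lemma rb_operator_conj:
  fixes R :: "'a::field mat \<Rightarrow> 'a mat"
  assumes R: "rb_operator n R" and c: "P \<in> carrier_mat n n" "Q \<in> carrier_mat n n"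
    and PQ: "P * Q = 1\<^sub>m n" and QP: "Q * P = 1\<^sub>m n"
  shows "rb_operator n (\<lambda>x. Q * R (P * x * Q) * P)"
proof -
  have conj: "P * x * Q \<in> carrier_mat n n" if "x \<in> carrier_mat n n" for x
    using c that by simp
  note cl = rb_operator_closed[OF R conj]
  have lin: "A * (x + y) * B = A * x * B + A * y * B"
    if "A \<in> carrier_mat n n" "B \<in> carrier_mat n n" "x \<in> carrier_mat n n" "y \<in> carrier_mat n n" for A B x y :: "'a mat"
    using that mult_add_distrib_mat[of A n n x n y] add_mult_distrib_mat[of "A * x" n n "A * y" B n] by simp
  have sm: "A * (k \<cdot>\<^sub>m x) * B = k \<cdot>\<^sub>m (A * x * B)"
    if "A \<in> carrier_mat n n" "B \<in> carrier_mat n n" "x \<in> carrier_mat n n" for A B x :: "'a mat" and k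
    using that mult_smult_distrib[of A n n x n k] mult_smult_assoc_mat[of "A * x" n n B n k] by simp
  have "(Q * R (P * x * Q) * P) * (Q * R (P * y * Q) * P) =
      Q * R (P * ((Q * R (P * x * Q) * P) * y + x * (Q * R (P * y * Q) * P)) * Q) * P"
    if x: "x \<in> carrier_mat n n" and y: "y \<in> carrier_mat n n" for x y
  proof -
    let ?X = "P * x * Q" and ?Y = "P * y * Q"
    have X: "R ?X \<in> carrier_mat n n" and Y: "R ?Y \<in> carrier_mat n n" using cl x y by auto
    then have X': "Q * R ?X * P \<in> carrier_mat n n" and Y': "Q * R ?Y * P \<in> carrier_mat n n"
      using c by auto
    have "(Q * R ?X * P) * (Q * R ?Y * P) = Q * (R ?X * R ?Y) * P"
      using conj_mat_mult[OF c(2,1) PQ X Y] by simp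
    also have "R ?X * R ?Y = R (R ?X * ?Y + ?X * R ?Y)"
      by (rule rb_operator_mult[OF R conj[OF x] conj[OF y]])
    also have "R ?X * ?Y = P * ((Q * R ?X * P) * y) * Q"
      by (simp add: conj_mat_mult[OF c QP X' y] conj_mat_inverse[OF c(2,1) PQ X])
    also have "?X * R ?Y = P * (x * (Q * R ?Y * P)) * Q"
      by (simp add: conj_mat_mult[OF c QP x Y'] conj_mat_inverse[OF c(2,1) PQ Y])
    also have "P * ((Q * R ?X * P) * y) * Q + P * (x * (Q * R ?Y * P)) * Q =
        P * ((Q * R ?X * P) * y + x * (Q * R ?Y * P)) * Q"
      using lin[OF c mult_carrier_mat[OF X' y] mult_carrier_mat[OF x Y']] by simp
    finally show ?thesis .
  qed
  moreover have "Q * R (P * x * Q) * P \<in> carrier_mat n n" if "x \<in> carrier_mat n n" for x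
    using c cl[OF that] by simp
  moreover have "Q * R (P * (x + y) * Q) * P = Q * R (P * x * Q) * P + Q * R (P * y * Q) * P"
    if "x \<in> carrier_mat n n" "y \<in> carrier_mat n n" for x y
    unfolding lin[OF c that] rb_operator_add[OF R conj[OF that(1)] conj[OF that(2)]]
    by (rule lin[OF c(2,1) cl[OF that(1)] cl[OF that(2)]])
  moreover have "Q * R (P * (k \<cdot>\<^sub>m x) * Q) * P = k \<cdot>\<^sub>m (Q * R (P * x * Q) * P)"
    if "x \<in> carrier_mat n n" for k x
    unfolding sm[OF c that] rb_operator_smult[OF R conj[OF that]]
    by (rule sm[OF c(2,1) cl[OF that]])
  ultimately show ?thesis unfolding rb_operator_def by blast
qed

lemma funpow_conj:
  fixes R :: "'a::field mat \<Rightarrow> 'a mat"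
  assumes R: "rb_operator n R" and c: "P \<in> carrier_mat n n" "Q \<in> carrier_mat n n"
    and PQ: "P * Q = 1\<^sub>m n" and QP: "Q * P = 1\<^sub>m n" and x: "x \<in> carrier_mat n n"
  shows "((\<lambda>x. Q * R (P * x * Q) * P) ^^ k) x = Q * (R ^^ k) (P * x * Q) * P"
proof (induction k)
  case 0
  show ?case using conj_mat_inverse[OF c QP x] by simp
next
  case (Suc k)
  have "(R ^^ k) (P * x * Q) \<in> carrier_mat n n"
    using c x by (intro rb_operator_funpow_closed[OF R]) simp
  then show ?case using Suc conj_mat_inverse[OF c(2,1) PQ] by simp
qed

section \<open>The shift as normal form of a regular nilpotent matrix\<close>

definition shift_mat :: "nat \<Rightarrow> 'a::zero_neq_one mat" where
  "shift_mat n = mat n n (\<lambda>(i, j). if j = Suc i then 1 else 0)"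

lemma shift_mat_carrier [simp]: "shift_mat n \<in> carrier_mat n n"
  by (simp add: shift_mat_def)

lemma shift_mat_mult_index:
  fixes Y :: "'a::semiring_1 mat"
  assumes "Y \<in> carrier_mat n n" "i < n" "j < n"
  shows "(shift_mat n * Y) $$ (i, j) = (if Suc i < n then Y $$ (Suc i, j) else 0)"
proof -
  have "(shift_mat n * Y) $$ (i, j) = (\<Sum>m<n. if m = Suc i then Y $$ (Suc i, j) else 0)"
    unfolding index_mult_mat_sum[OF shift_mat_carrier assms] using assms
    by (intro sum.cong) (auto simp: shift_mat_def)
  then show ?thesis by simp
qed

lemma mult_shift_mat_index:
  fixes Y :: "'a::semiring_1 mat"
  assumes "Y \<in> carrier_mat n n" "i < n" "j < n"
  shows "(Y * shift_mat n) $$ (i, j) = (if j = 0 then 0 else Y $$ (i, j - 1))"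
proof -
  have "(Y * shift_mat n) $$ (i, j) =
      (\<Sum>m<n. if m = j - 1 then (if j = 0 then 0 else Y $$ (i, j - 1)) else 0)"
    unfolding index_mult_mat_sum[OF assms(1) shift_mat_carrier assms(2,3)] using assms
    by (intro sum.cong) (auto simp: shift_mat_def)
  then show ?thesis using assms by auto
qed

lemma shift_mat_pow_index:
  assumes "i < n" "j < n"
  shows "((shift_mat n :: 'a::semiring_1 mat) ^\<^sub>m k) $$ (i, j) = (if j = i + k then 1 else 0)"
  using assms
proof (induction k arbitrary: j)
  case 0
  then show ?case by (auto simp: shift_mat_def)
next
  case (Suc k)
  then show ?case
    by (auto simp: mult_shift_mat_index[OF pow_carrier_mat[OF shift_mat_carrier]])
qed

lemma regular_nilpotent_similar_shift:
  fixes a :: "'a::field mat"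
  assumes n: "n \<ge> 1" and a: "a \<in> carrier_mat n n"
    and nil: "a ^\<^sub>m n = 0\<^sub>m n n" and ne: "a ^\<^sub>m (n - 1) \<noteq> 0\<^sub>m n n"
  shows "\<exists>P Q. P \<in> carrier_mat n n \<and> Q \<in> carrier_mat n n \<and> P * Q = 1\<^sub>m n \<and> Q * P = 1\<^sub>m n \<and>
    Q * a * P = shift_mat n"
proof -
  obtain i0 j where ij: "i0 < n" "j < n" "(a ^\<^sub>m (n - 1)) $$ (i0, j) \<noteq> 0"
    using mat_nonzero_index[OF pow_carrier_mat[OF a] ne] by blast
  \<comment> \<open>The Krylov basis in reverse order, so that \<open>a\<close> sends column
    \<open>k\<close> to column \<open>k - 1\<close> and column 0 to zero: ones on the superdiagonal.
    Invertibility is \<open>krylov_independent\<close>.\<close>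
  define P where "P = mat n n (\<lambda>(i, k). (a ^\<^sub>m (n - Suc k)) $$ (i, j))"
  have P: "P \<in> carrier_mat n n" by (simp add: P_def)
  have nil': "a ^\<^sub>m Suc (n - 1) = 0\<^sub>m n n" using nil n by simp
  have "det P \<noteq> 0"
  proof
    assume "det P = 0"
    then obtain v where v: "v \<in> carrier_vec n" "v \<noteq> 0\<^sub>v n" "P *\<^sub>v v = 0\<^sub>v n"
      using det_0_iff_vec_prod_zero_field[OF P] by blast
    have dep: "(\<Sum>k<n. v $ (n - Suc k) * (a ^\<^sub>m k) $$ (i, j)) = 0" if "i < n" for i
    proof -
      have "0 = (P *\<^sub>v v) $ i" using v(3) that by simp
      also have "\<dots> = (\<Sum>k<n. v $ k * (a ^\<^sub>m (n - Suc k)) $$ (i, j))"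
        using that v(1) by (auto simp: P_def scalar_prod_def lessThan_atLeast0 mult.commute intro!: sum.cong)
      also have "\<dots> = (\<Sum>k<n. v $ (n - Suc k) * (a ^\<^sub>m (n - Suc (n - Suc k))) $$ (i, j))"
        by (rule sum.nat_diff_reindex[symmetric])
      also have "\<dots> = (\<Sum>k<n. v $ (n - Suc k) * (a ^\<^sub>m k) $$ (i, j))"
        by (intro sum.cong) auto
      finally show ?thesis by simp
    qed
    have "v $ (n - Suc k) = 0" if "k < n" for k
      using krylov_independent[OF a nil' ij _ dep that] n by simp
    then have "v $ k = 0" if "k < n" for k
      using that by (metis Suc_diff_Suc diff_Suc_less diff_diff_cancel less_imp_le_nat less_nat_zero_code not_gr_zero)
    then have "v = 0\<^sub>v n" using v(1) by (intro eq_vecI) auto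
    then show False using v(2) by simp
  qed
  from det_non_zero_imp_unit[OF P this, of "()"] obtain Q where
    Q: "Q \<in> carrier_mat n n" "P * Q = 1\<^sub>m n" "Q * P = 1\<^sub>m n"
    unfolding Units_def ring_mat_def by auto
  have "a * P = P * shift_mat n"
  proof (rule eq_matI)
    fix i k assume "i < dim_row (P * shift_mat n)" "k < dim_col (P * shift_mat n)"
    then have ik: "i < n" "k < n" by (simp_all add: P_def shift_mat_def)
    have "(a * P) $$ (i, k) = (\<Sum>m<n. a $$ (i, m) * (a ^\<^sub>m (n - Suc k)) $$ (m, j))"
      unfolding index_mult_mat_sum[OF a P ik] using ik by (simp add: P_def)
    also have "\<dots> = (a ^\<^sub>m 1 * a ^\<^sub>m (n - Suc k)) $$ (i, j)"
      using index_mult_mat_sum[OF a pow_carrier_mat[OF a] ik(1) ij(2)] a by simp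
    also have "a ^\<^sub>m 1 * a ^\<^sub>m (n - Suc k) = a ^\<^sub>m (n - k)"
      using pow_mat_add[OF a, of 1 "n - Suc k"] ik by (simp add: Suc_diff_Suc)
    also have "(a ^\<^sub>m (n - k)) $$ (i, j) = (P * shift_mat n) $$ (i, k)"
      unfolding mult_shift_mat_index[OF P ik] using ik ij nil by (cases k) (auto simp: P_def)
    finally show "(a * P) $$ (i, k) = (P * shift_mat n) $$ (i, k)" .
  qed (use a P in \<open>auto simp: shift_mat_def\<close>)
  then have "Q * a * P = (Q * P) * shift_mat n"
    using assoc_mult_mat[OF Q(1) a P] assoc_mult_mat[OF Q(1) P shift_mat_carrier] by simp
  then have "Q * a * P = shift_mat n" by (simp add: Q(3) left_mult_one_mat[OF shift_mat_carrier])
  then show ?thesis using P Q by blast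
qed

text \<open>The recurrence preserves p+q+s. Solving it for the term with larger \<open>s\<close>, by
  division by \<open>s\<close>, descends to s = 1 and p+q = 2n-2, where the boundary condition
  leaves only p = q = n-1. The constant precedes \<open>F\<close> so that one value serves every
  family.\<close>

lemma telescoping_corner:
  assumes n: "n \<ge> 1"
  shows "\<exists>c::'a::field_char_0. \<forall>F.
    (\<forall>p q s. 1 \<le> s \<longrightarrow> F (Suc p) q s = F p (Suc q) s + of_nat s * F p q (Suc s)) \<longrightarrow>
    (\<forall>p q s. n \<le> p \<or> n \<le> q \<longrightarrow> F p q s = 0) \<longrightarrow>
    F 0 0 (2 * n - 1) = c * F (n - 1) (n - 1) 1"
proof -
  have "\<exists>c::'a. \<forall>F.
    (\<forall>p q s. 1 \<le> s \<longrightarrow> F (Suc p) q s = F p (Suc q) s + of_nat s * F p q (Suc s)) \<longrightarrow>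
    (\<forall>p q s. n \<le> p \<or> n \<le> q \<longrightarrow> F p q s = 0) \<longrightarrow>
    F p q (Suc s) = c * F (n - 1) (n - 1) 1" if "p + q + Suc s = 2 * n - 1" for p q s
    using that
  proof (induction s arbitrary: p q)
    case 0
    show ?case
    proof (cases "p = n - 1 \<and> q = n - 1")
      case True
      then show ?thesis by (intro exI[of _ 1]) simp
    next
      case False
      then have "n \<le> p \<or> n \<le> q" using 0 by auto
      then show ?thesis by (intro exI[of _ 0]) fastforce
    qed
  next
    case (Suc s)
    obtain c1 :: 'a where c1: "\<And>F. \<forall>p q s. 1 \<le> s \<longrightarrow> F (Suc p) q s = F p (Suc q) s + of_nat s * F p q (Suc s) \<Longrightarrow>
      \<forall>p q s. n \<le> p \<or> n \<le> q \<longrightarrow> F p q s = 0 \<Longrightarrow> F (Suc p) q (Suc s) = c1 * F (n - 1) (n - 1) 1"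
      using Suc.IH[of "Suc p" q] Suc.prems by auto
    obtain c2 :: 'a where c2: "\<And>F. \<forall>p q s. 1 \<le> s \<longrightarrow> F (Suc p) q s = F p (Suc q) s + of_nat s * F p q (Suc s) \<Longrightarrow>
      \<forall>p q s. n \<le> p \<or> n \<le> q \<longrightarrow> F p q s = 0 \<Longrightarrow> F p (Suc q) (Suc s) = c2 * F (n - 1) (n - 1) 1"
      using Suc.IH[of p "Suc q"] Suc.prems by auto
    show ?case
    proof (intro exI[of _ "(c1 - c2) / of_nat (Suc s)"] allI impI)
      fix F :: "nat \<Rightarrow> nat \<Rightarrow> nat \<Rightarrow> 'a"
      assume F: "\<forall>p q s. 1 \<le> s \<longrightarrow> F (Suc p) q s = F p (Suc q) s + of_nat s * F p q (Suc s)"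
        "\<forall>p q s. n \<le> p \<or> n \<le> q \<longrightarrow> F p q s = 0"
      have "of_nat (Suc s) * F p q (Suc (Suc s)) = F (Suc p) q (Suc s) - F p (Suc q) (Suc s)"
        using F(1) by (simp del: of_nat_Suc)
      also have "\<dots> = (c1 - c2) * F (n - 1) (n - 1) 1"
        unfolding c1[OF F] c2[OF F] by (simp add: algebra_simps)
      finally show "F p q (Suc (Suc s)) = (c1 - c2) / of_nat (Suc s) * F (n - 1) (n - 1) 1"
        by (simp add: field_simps del: of_nat_Suc)
    qed
  qed
  from this[of 0 0 "2 * n - 2"] show ?thesis using n by (simp add: Suc_diff_le)
qed

lemma rb_funpow_corner:
  fixes n :: nat
  assumes n: "n \<ge> 1"
  shows "\<exists>c::'a::field_char_0. \<forall>R x. rb_operator n R \<longrightarrow> x \<in> carrier_mat n n \<longrightarrow>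
    (R ^^ (2 * n - 1)) x = c \<cdot>\<^sub>m (R (1\<^sub>m n) ^\<^sub>m (n - 1) * R (R (1\<^sub>m n) ^\<^sub>m (n - 1) * x)) \<and>
    (R ^^ (2 * n - 1)) x = c \<cdot>\<^sub>m (R (x * R (1\<^sub>m n) ^\<^sub>m (n - 1)) * R (1\<^sub>m n) ^\<^sub>m (n - 1))"
proof -
  obtain c :: 'a where c: "\<And>F.
    \<forall>p q s. 1 \<le> s \<longrightarrow> F (Suc p) q s = F p (Suc q) s + of_nat s * F p q (Suc s) \<Longrightarrow>
    \<forall>p q s. n \<le> p \<or> n \<le> q \<longrightarrow> F p q s = 0 \<Longrightarrow>
    F 0 0 (2 * n - 1) = c * F (n - 1) (n - 1) 1"
    using telescoping_corner[OF n] by blast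
  show ?thesis
  proof (intro exI[of _ c] allI impI)
    fix R :: "'a mat \<Rightarrow> 'a mat" and x :: "'a mat"
    assume R: "rb_operator n R" and x: "x \<in> carrier_mat n n"
    define a where "a = R (1\<^sub>m n)"
    have a: "a \<in> carrier_mat n n" by (simp add: a_def rb_operator_closed[OF R])
    note ap = pow_carrier_mat[OF a]
    note cl = rb_operator_funpow_closed[OF R]
    have nil: "a ^\<^sub>m p = 0\<^sub>m n n" if "n \<le> p" for p
    proof -
      have "a ^\<^sub>m p = a ^\<^sub>m n * a ^\<^sub>m (p - n)" using pow_mat_add[OF a, of n "p - n"] that by simp
      also have "a ^\<^sub>m n = 0\<^sub>m n n" unfolding a_def by (rule rb_one_pow_dim[OF R])
      finally show ?thesis using a by simp
    qed
    have comm: "a * a ^\<^sub>m k = a ^\<^sub>m k * a" for k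
      using pow_mat_add[OF a, of 1 k] a by simp
    \<comment> \<open>Entries of these two families play the role of \<open>F\<close>: the
      commutator formulas give the recurrence, a^n = 0 the boundary condition. Sharing the constant
      makes the two expressions comparable.\<close>
    define L where "L p q s = a ^\<^sub>m p * (R ^^ s) (a ^\<^sub>m q * x)" for p q s
    define M where "M p q s = (R ^^ s) (x * a ^\<^sub>m q) * a ^\<^sub>m p" for p q s
    have L: "L p q s \<in> carrier_mat n n" and M: "M p q s \<in> carrier_mat n n" for p q s
      unfolding L_def M_def using ap cl x by (auto intro!: mult_carrier_mat[of _ n n])
    have L_Suc: "L (Suc p) q s = L p (Suc q) s + of_nat s \<cdot>\<^sub>m L p q (Suc s)" for p q s
    proof -
      let ?y = "a ^\<^sub>m q * x"
      have y: "?y \<in> carrier_mat n n" by (rule mult_carrier_mat[OF ap x])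
      have ay: "a * ?y = a ^\<^sub>m Suc q * x"
        using assoc_mult_mat[OF a ap x] by (simp add: comm)
      have "L (Suc p) q s = a ^\<^sub>m p * (a * (R ^^ s) ?y)"
        unfolding L_def using assoc_mult_mat[OF ap a cl[OF y]] by simp
      also have "a * (R ^^ s) ?y = (R ^^ s) (a ^\<^sub>m Suc q * x) + of_nat s \<cdot>\<^sub>m (R ^^ Suc s) ?y"
        using rb_one_mult_funpow[OF R y, of s] ay unfolding a_def by simp
      also have "a ^\<^sub>m p * \<dots> = L p (Suc q) s + a ^\<^sub>m p * (of_nat s \<cdot>\<^sub>m (R ^^ Suc s) ?y)"
        unfolding L_def
        by (rule mult_add_distrib_mat[OF ap cl[OF mult_carrier_mat[OF ap x]] smult_carrier_mat[OF cl[OF y]]])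
      also have "a ^\<^sub>m p * (of_nat s \<cdot>\<^sub>m (R ^^ Suc s) ?y) = of_nat s \<cdot>\<^sub>m L p q (Suc s)"
        unfolding L_def by (rule mult_smult_distrib[OF ap cl[OF y]])
      finally show ?thesis .
    qed
    have M_Suc: "M (Suc p) q s = M p (Suc q) s + of_nat s \<cdot>\<^sub>m M p q (Suc s)" for p q s
    proof -
      let ?y = "x * a ^\<^sub>m q"
      have y: "?y \<in> carrier_mat n n" by (rule mult_carrier_mat[OF x ap])
      have ya: "?y * a = x * a ^\<^sub>m Suc q" using assoc_mult_mat[OF x ap a] by simp
      have "M (Suc p) q s = ((R ^^ s) ?y * a) * a ^\<^sub>m p"
        unfolding M_def using assoc_mult_mat[OF cl[OF y] a ap] by (simp add: comm)
      also have "(R ^^ s) ?y * a = (R ^^ s) (x * a ^\<^sub>m Suc q) + of_nat s \<cdot>\<^sub>m (R ^^ Suc s) ?y"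
        using rb_funpow_mult_one[OF R y, of s] ya unfolding a_def by simp
      also have "\<dots> * a ^\<^sub>m p = M p (Suc q) s + (of_nat s \<cdot>\<^sub>m (R ^^ Suc s) ?y) * a ^\<^sub>m p"
        unfolding M_def
        by (rule add_mult_distrib_mat[OF cl[OF mult_carrier_mat[OF x ap]] smult_carrier_mat[OF cl[OF y]] ap])
      also have "(of_nat s \<cdot>\<^sub>m (R ^^ Suc s) ?y) * a ^\<^sub>m p = of_nat s \<cdot>\<^sub>m M p q (Suc s)"
        unfolding M_def by (rule mult_smult_assoc_mat[OF cl[OF y] ap])
      finally show ?thesis .
    qed
    have zero: "L p q s = 0\<^sub>m n n" "M p q s = 0\<^sub>m n n" if "n \<le> p \<or> n \<le> q" for p q s
      using that nil[of p] nil[of q] unfolding L_def M_def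
      by (auto simp: rb_operator_funpow_zero[OF R] left_mult_zero_mat[OF x] right_mult_zero_mat[OF x]
          left_mult_zero_mat[OF ap] right_mult_zero_mat[OF ap]
          left_mult_zero_mat[OF cl[OF mult_carrier_mat[OF ap x]]]
          right_mult_zero_mat[OF cl[OF mult_carrier_mat[OF x ap]]])
    have "L 0 0 (2 * n - 1) = c \<cdot>\<^sub>m L (n - 1) (n - 1) 1"
    proof (rule eq_matI)
      fix i j assume "i < dim_row (c \<cdot>\<^sub>m L (n - 1) (n - 1) 1)" "j < dim_col (c \<cdot>\<^sub>m L (n - 1) (n - 1) 1)"
      then have ij: "i < n" "j < n" using L[of "n - 1" "n - 1" 1] by auto
      have "L (Suc p) q s $$ (i, j) = L p (Suc q) s $$ (i, j) + of_nat s * L p q (Suc s) $$ (i, j)" for p q s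
        unfolding L_Suc using L[of p "Suc q" s] L[of p q "Suc s"] ij by simp
      then show "L 0 0 (2 * n - 1) $$ (i, j) = (c \<cdot>\<^sub>m L (n - 1) (n - 1) 1) $$ (i, j)"
        using c[of "\<lambda>p q s. L p q s $$ (i, j)"] zero ij L[of "n - 1" "n - 1" 1] by simp
    qed (use L[of "n - 1" "n - 1" 1] L[of 0 0 "2 * n - 1"] in auto)
    moreover have "M 0 0 (2 * n - 1) = c \<cdot>\<^sub>m M (n - 1) (n - 1) 1"
    proof (rule eq_matI)
      fix i j assume "i < dim_row (c \<cdot>\<^sub>m M (n - 1) (n - 1) 1)" "j < dim_col (c \<cdot>\<^sub>m M (n - 1) (n - 1) 1)"
      then have ij: "i < n" "j < n" using M[of "n - 1" "n - 1" 1] by auto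
      have "M (Suc p) q s $$ (i, j) = M p (Suc q) s $$ (i, j) + of_nat s * M p q (Suc s) $$ (i, j)" for p q s
        unfolding M_Suc using M[of p "Suc q" s] M[of p q "Suc s"] ij by simp
      then show "M 0 0 (2 * n - 1) $$ (i, j) = (c \<cdot>\<^sub>m M (n - 1) (n - 1) 1) $$ (i, j)"
        using c[of "\<lambda>p q s. M p q s $$ (i, j)"] zero ij M[of "n - 1" "n - 1" 1] by simp
    qed (use M[of "n - 1" "n - 1" 1] M[of 0 0 "2 * n - 1"] in auto)
    moreover have "L 0 0 (2 * n - 1) = (R ^^ (2 * n - 1)) x" "M 0 0 (2 * n - 1) = (R ^^ (2 * n - 1)) x"
      using x a left_mult_one_mat[OF cl[OF x]] right_mult_one_mat[OF cl[OF x]] by (simp_all add: L_def M_def)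
    ultimately show "(R ^^ (2 * n - 1)) x = c \<cdot>\<^sub>m (R (1\<^sub>m n) ^\<^sub>m (n - 1) * R (R (1\<^sub>m n) ^\<^sub>m (n - 1) * x)) \<and>
        (R ^^ (2 * n - 1)) x = c \<cdot>\<^sub>m (R (x * R (1\<^sub>m n) ^\<^sub>m (n - 1)) * R (1\<^sub>m n) ^\<^sub>m (n - 1))"
      unfolding L_def M_def a_def by simp
  qed
qed

lemma rb_funpow_shift_eq_0:
  fixes R :: "'a::field_char_0 mat \<Rightarrow> 'a mat"
  assumes n: "n \<ge> 1" and R: "rb_operator n R" and one: "R (1\<^sub>m n) = shift_mat n"
    and x: "x \<in> carrier_mat n n"
  shows "(R ^^ (2 * n - 1)) x = 0\<^sub>m n n"
proof -
  let ?E = "mat_unit n :: nat \<Rightarrow> nat \<Rightarrow> 'a mat"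
  let ?b = "?E 0 (n - 1)"
  have b: "(shift_mat n :: 'a mat) ^\<^sub>m (n - 1) = ?b"
    by (rule eq_matI) (auto simp: shift_mat_pow_index, simp_all add: shift_mat_def)
  obtain c :: 'a where c: "\<And>x. x \<in> carrier_mat n n \<Longrightarrow> (R ^^ (2 * n - 1)) x = c \<cdot>\<^sub>m (?b * R (?b * x))"
    "\<And>x. x \<in> carrier_mat n n \<Longrightarrow> (R ^^ (2 * n - 1)) x = c \<cdot>\<^sub>m (R (x * ?b) * ?b)"
    using rb_funpow_corner[OF n, where 'a = 'a] R one b by metis
  note cl = rb_operator_closed[OF R]
  have bx: "?b * y \<in> carrier_mat n n" "y * ?b \<in> carrier_mat n n" if "y \<in> carrier_mat n n" for y
    using that by (auto intro: mult_carrier_mat)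
  show ?thesis
  \<comment> \<open>This case split spares computing \<open>c\<close>; if it is nonzero, it can be
    cancelled from the two corner formulas.\<close>
  proof (cases "c = 0")
    case True
    then show ?thesis using c(1)[OF x] cl[OF bx(1)[OF x]] by (intro eq_matI) auto
  next
    case False
    define r where "r p q i j = R (?E p q) $$ (i, j)" for p q i j
    define lam where "lam = r (n - 1) (n - 1) 0 0"
    have rb: "rb_const n r" unfolding r_def by (rule rb_const_of_operator[OF R])
    \<comment> \<open>Compare row 0 of both corner formulas at x = E_(n-1,k): b x is E_0k, while x b
      is E_(n-1,n-1) for \<open>k = 0\<close> and zero otherwise.\<close>
    have top: "r 0 k (n - 1) j = (if k = 0 \<and> j = n - 1 then lam else 0)" if kj: "k < n" "j < n" for k j
    proof -
      let ?x = "?E (n - 1) k"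
      have n0: "0 < n" "n - 1 < n" using n by auto
      have "?b * ?x = ?E 0 k"
        by (rule eq_matI) (use n0 in \<open>auto simp: mat_unit_mult_index simp del: index_mult_mat(1)\<close>)
      then have "(?b * R (?b * ?x)) $$ (0, j) = r 0 k (n - 1) j"
        using mat_unit_mult_index[OF cl[OF mat_unit_carrier] n0(2,1) kj(2)] by (simp add: r_def)
      moreover have "?x * ?b = (if k = 0 then ?E (n - 1) (n - 1) else 0\<^sub>m n n)"
        by (rule eq_matI) (use n0 in \<open>auto simp: mult_mat_unit_index simp del: index_mult_mat(1)\<close>)
      then have "R (?x * ?b) $$ (0, 0) = (if k = 0 then lam else 0)"
        using n0 by (simp add: r_def lam_def rb_operator_zero[OF R])
      then have "(R (?x * ?b) * ?b) $$ (0, j) = (if k = 0 \<and> j = n - 1 then lam else 0)"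
        unfolding mult_mat_unit_index[OF cl[OF bx(2)[OF mat_unit_carrier]] n0(1,1) kj(2)] by auto
      moreover have "c * (?b * R (?b * ?x)) $$ (0, j) = c * (R (?x * ?b) * ?b) $$ (0, j)"
      proof -
        have "c \<cdot>\<^sub>m (?b * R (?b * ?x)) = c \<cdot>\<^sub>m (R (?x * ?b) * ?b)"
          using c[OF mat_unit_carrier] by simp
        moreover have "(c \<cdot>\<^sub>m Z) $$ (0, j) = c * Z $$ (0, j)" if "Z \<in> carrier_mat n n" for Z
          using that n0 kj by simp
        note this[OF bx(1)[OF cl[OF bx(1)[OF mat_unit_carrier]]]]
          this[OF bx(2)[OF cl[OF bx(2)[OF mat_unit_carrier]]]]
        ultimately show ?thesis by metis
      qed
      ultimately show ?thesis using False by simp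
    qed
    \<comment> \<open>The left and right commutator formulas for one application of R share the term
      R(R(x)); subtracting removes it.\<close>
    have com: "(if p = 0 then 0 else r (p - 1) q i j) - (if Suc q < n then r p (Suc q) i j else 0) =
      (if Suc i < n then r p q (Suc i) j else 0) - (if j = 0 then 0 else r p q i (j - 1))"
      if pq: "p < n" "q < n" and ij: "i < n" "j < n" for p q i j
    proof -
      let ?J = "shift_mat n :: 'a mat" and ?x = "?E p q"
      have c1: "?J * ?x \<in> carrier_mat n n" and c2: "?x * ?J \<in> carrier_mat n n"
        by (simp_all add: mult_carrier_mat[OF shift_mat_carrier mat_unit_carrier]
            mult_carrier_mat[OF mat_unit_carrier shift_mat_carrier])
      have RR: "R (R ?x) \<in> carrier_mat n n" by (intro cl) simp
      have one_RR: "1 \<cdot>\<^sub>m R (R ?x) = R (R ?x)" by (intro eq_matI) auto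
      have "?J * ?x = (if p = 0 then 0\<^sub>m n n else ?E (p - 1) q)"
        by (rule eq_matI) (use pq in \<open>auto simp: shift_mat_mult_index simp del: index_mult_mat(1)\<close>, auto simp: shift_mat_def)
      then have 1: "R (?J * ?x) $$ (i, j) = (if p = 0 then 0 else r (p - 1) q i j)"
        using ij by (simp add: r_def rb_operator_zero[OF R])
      have "?x * ?J = (if Suc q < n then ?E p (Suc q) else 0\<^sub>m n n)"
        by (rule eq_matI) (use pq in \<open>auto simp: mult_shift_mat_index simp del: index_mult_mat(1)\<close>, auto simp: shift_mat_def)
      then have 2: "R (?x * ?J) $$ (i, j) = (if Suc q < n then r p (Suc q) i j else 0)"
        using ij by (simp add: r_def rb_operator_zero[OF R])
      have "?J * R ?x = R (?J * ?x) + R (R ?x)"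
        using rb_one_mult_funpow[OF R mat_unit_carrier[of n p q], of 1]
        by (simp add: one one_RR)
      from arg_cong[OF this, of "\<lambda>A. A $$ (i, j)"]
      have 3: "(if Suc i < n then r p q (Suc i) j else 0) = R (?J * ?x) $$ (i, j) + R (R ?x) $$ (i, j)"
        using shift_mat_mult_index[OF cl[OF mat_unit_carrier] ij] cl[OF c1] RR ij
        by (simp add: r_def del: index_mult_mat split: if_splits)
      have "R ?x * ?J = R (?x * ?J) + R (R ?x)"
        using rb_funpow_mult_one[OF R mat_unit_carrier[of n p q], of 1]
        by (simp add: one one_RR)
      from arg_cong[OF this, of "\<lambda>A. A $$ (i, j)"]
      have 4: "(if j = 0 then 0 else r p q i (j - 1)) = R (?x * ?J) $$ (i, j) + R (R ?x) $$ (i, j)"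
        using mult_shift_mat_index[OF cl[OF mat_unit_carrier] ij] cl[OF c2] RR ij
        by (simp add: r_def del: index_mult_mat split: if_splits)
      show ?thesis unfolding 1[symmetric] 2[symmetric] 3 4 by simp
    qed
    have "lam = 0" by (rule rb_const_shift_corner_eq_0[OF n rb com top])
    \<comment> \<open>\<open>?b * x\<close> lives in row 0, and with \<open>lam = 0\<close> the
      images of all E_0q have zero last row, the only row that left multiplication by
      \<open>?b\<close> retains.\<close>
    have last: "R (?b * x) $$ (n - 1, j) = 0" if j: "j < n" for j
    proof -
      have "R (?b * x) $$ (n - 1, j) = (\<Sum>p<n. \<Sum>q<n. (?b * x) $$ (p, q) * r p q (n - 1) j)"
        unfolding r_def using n j by (intro rb_operator_index[OF R bx(1)[OF x]]) auto
      also have "\<dots> = 0"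
      proof (intro sum.neutral ballI)
        fix p q assume "p \<in> {..<n}" "q \<in> {..<n}"
        then show "(?b * x) $$ (p, q) * r p q (n - 1) j = 0"
          using mat_unit_mult_index[OF x, of "n - 1" p q 0] top[of q j] \<open>lam = 0\<close> j n
          by (simp del: index_mult_mat)
      qed
      finally show ?thesis .
    qed
    have "(?b * R (?b * x)) $$ (i, j) = 0" if "i < n" "j < n" for i j
      using mat_unit_mult_index[OF cl[OF bx(1)[OF x]], of "n - 1" i j 0] last[of j] that n by simp
    then have "?b * R (?b * x) = 0\<^sub>m n n"
      using bx(1)[OF cl[OF bx(1)[OF x]]] by (intro eq_matI) auto
    then show ?thesis using c(1)[OF x] by (intro eq_matI) auto
  qed
qed

text \<open>If R(1)^(n-1) = 0, the corner formula already vanishes. Otherwise R(1) is similar to the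
  shift, and the result is transported back.\<close>

lemma rb_funpow_eq_0:
  fixes R :: "'a::field_char_0 mat \<Rightarrow> 'a mat"
  assumes n: "n \<ge> 1" and R: "rb_operator n R" and x: "x \<in> carrier_mat n n"
  shows "(R ^^ (2 * n - 1)) x = 0\<^sub>m n n"
proof (cases "R (1\<^sub>m n) ^\<^sub>m (n - 1) = 0\<^sub>m n n")
  case True
  obtain c :: 'a where "(R ^^ (2 * n - 1)) x = c \<cdot>\<^sub>m (0\<^sub>m n n * R (0\<^sub>m n n * x))"
    using rb_funpow_corner[OF n, where 'a = 'a] R x unfolding True[symmetric] by blast
  moreover have "R (0\<^sub>m n n * x) \<in> carrier_mat n n"
    by (rule rb_operator_closed[OF R mult_carrier_mat[OF zero_carrier_mat x]])
  ultimately show ?thesis by (intro eq_matI) auto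
next
  case False
  have a: "R (1\<^sub>m n) \<in> carrier_mat n n" by (rule rb_operator_closed[OF R one_carrier_mat])
  obtain P Q where c: "P \<in> carrier_mat n n" "Q \<in> carrier_mat n n"
    and PQ: "P * Q = 1\<^sub>m n" and QP: "Q * P = 1\<^sub>m n" and s: "Q * R (1\<^sub>m n) * P = shift_mat n"
    using regular_nilpotent_similar_shift[OF n a rb_one_pow_dim[OF R] False] by blast
  let ?R = "\<lambda>x. Q * R (P * x * Q) * P"
  have y: "Q * x * P \<in> carrier_mat n n" using c x by simp
  have Rx: "(R ^^ (2 * n - 1)) x \<in> carrier_mat n n" by (rule rb_operator_funpow_closed[OF R x])
  have "?R (1\<^sub>m n) = shift_mat n" using c by (simp add: PQ s)
  from rb_funpow_shift_eq_0[OF n rb_operator_conj[OF R c PQ QP] this y]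
  have "Q * (R ^^ (2 * n - 1)) x * P = 0\<^sub>m n n"
    unfolding funpow_conj[OF R c PQ QP y] conj_mat_inverse[OF c(2,1) PQ x] .
  then have "P * (Q * (R ^^ (2 * n - 1)) x * P) * Q = 0\<^sub>m n n" using c by simp
  then show ?thesis unfolding conj_mat_inverse[OF c(2,1) PQ Rx] .
qed

theorem mainTheorem19:
  fixes n :: nat
  assumes "n \<ge> 1"
  shows "rb_index TYPE('a::field_char_0) n = enat (2 * n - 1)"
proof -
  let ?P = "\<lambda>m. \<forall>R::'a mat \<Rightarrow> 'a mat. rb_operator n R \<longrightarrow> rb_nilpotent_of n m R"
  let ?R = "op_of_const n (max_rb_const :: _ \<Rightarrow> _ \<Rightarrow> _ \<Rightarrow> _ \<Rightarrow> 'a)"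
  have upper: "?P (2 * n - 1)"
    unfolding rb_nilpotent_of_def using rb_funpow_eq_0[OF assms] by blast
  have R: "rb_operator n ?R" by (rule rb_operator_op_of_const[OF rb_const_max_rb_const])
  have lower: "2 * n - 1 \<le> m" if m: "?P m" for m
  proof (rule ccontr)
    assume "\<not> 2 * n - 1 \<le> m"
    then have "2 * n - 2 = (2 * n - 2 - m) + m" by simp
    moreover have "(?R ^^ m) (mat_unit n (n - 1) 0) = 0\<^sub>m n n"
      using m R unfolding rb_nilpotent_of_def by simp
    ultimately have "(?R ^^ (2 * n - 2)) (mat_unit n (n - 1) 0) = 0\<^sub>m n n"
      using rb_operator_funpow_zero[OF R] by (metis funpow_add o_apply)
    then show False using max_rb_funpow_ne_0[OF assms] by blast
  qed
  have "(LEAST m. ?P m) = 2 * n - 1"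
    by (rule Least_equality[of ?P, OF upper lower])
  then show ?thesis unfolding rb_index_def using upper by auto
qed

end
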